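(* Fix $L>0$. There exist $C<\infty$ and $\varepsilon_0>0$ (depending on $L$) such that for all $0<\varepsilon<\varepsilon_0$, $$\limsup_{t\to\infty}\mathbb{P}\Big\{\sup_{z\in[0,\varepsilon t^{2/3}]}\{N(z)+A_t(z)\}-A_t(0)\ge L\,t^{1/3}\Big\}\le C\varepsilon^3 .$$
   Context: Stationary Hammersley process with parameter $1$: independent Poisson processes of $\alpha$-points (intensity 1 in $(0,\infty)^2$), sources (intensity 1 on $(0,\infty)\times\{0\}$) and sinks (intensity 1 on $\{0\}\times(0,\infty)$). For $0\le z\le t$ let $N(z)$ be the number of sources in $(0,z]\times\{0\}$, and let $A_t(z)$ be the maximal length $k$ of a chain of $\alpha$-points $(x_1,t_1),\dots,(x_k,t_k)\in(z,t]\times(0,t]$ with $x_1<\dots<x_k$, $t_1<\dots<t_k$ (longest strictly North–East path from $(z,0)$ to $(t,t)$). *)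

theory Defs
  imports "HOL-Probability.Probability"
begin

text \<open>Region carrying the alpha-points: the open quadrant (0,inf)^2.
  Sources live on (0,inf) x {0}; we record only their first coordinate.\<close>

definition quadrant :: "(real \<times> real) set" where
  "quadrant = {0<..} \<times> {0<..}"

definition fin_borel_in :: "'b::euclidean_space set \<Rightarrow> 'b set \<Rightarrow> bool" where
  "fin_borel_in D B \<longleftrightarrow> B \<in> sets lborel \<and> B \<subseteq> D \<and> emeasure lborel B < \<infinity>"

definition poisson_counts :: "'a measure \<Rightarrow> ('a \<Rightarrow> 'b::euclidean_space set) \<Rightarrow> 'b set \<Rightarrow> bool" where
  "poisson_counts M X D \<longleftrightarrow>
     (\<forall>B. fin_borel_in D B \<longrightarrow>
        (\<forall>k::nat. {\<omega> \<in> space M. finite (X \<omega> \<inter> B) \<and> card (X \<omega> \<inter> B) = k} \<in> sets M \<and>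
           measure M {\<omega> \<in> space M. finite (X \<omega> \<inter> B) \<and> card (X \<omega> \<inter> B) = k}
             = measure lborel B ^ k / fact k * exp (- measure lborel B)))"

text \<open>The (relevant part of the) stationary Hammersley process with parameter 1 on the
  probability space M: P is a Poisson process of intensity 1 (Lebesgue) on (0,inf)^2
  (alpha-points), S a Poisson process of intensity 1 on (0,inf) (sources), independent.
  Characterised by: Poisson counts on Borel sets of finite measure, and joint
  independence of the counts over any finite families of pairwise disjoint such sets
  of both processes.\<close>
definition hammersley :: "'a measure \<Rightarrow> ('a \<Rightarrow> (real \<times> real) set) \<Rightarrow> ('a \<Rightarrow> real set) \<Rightarrow> bool" where
  "hammersley M P S \<longleftrightarrow>
     prob_space M \<and>
     (\<forall>\<omega> \<in> space M. P \<omega> \<subseteq> quadrant \<and> S \<omega> \<subseteq> {0<..}) \<and>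
     poisson_counts M P quadrant \<and> poisson_counts M S {0<..} \<and>
     (\<forall>(I::nat set) (J::nat set) B U.
        finite I \<and> finite J \<and> (\<forall>i\<in>I. fin_borel_in quadrant (B i)) \<and> disjoint_family_on B I \<and>
        (\<forall>j\<in>J. fin_borel_in {0<..} (U j)) \<and> disjoint_family_on U J \<longrightarrow>
        prob_space.indep_vars M (\<lambda>_. count_space (UNIV :: nat set))
          (\<lambda>x \<omega>. case x of Inl i \<Rightarrow> card (P \<omega> \<inter> B i) | Inr j \<Rightarrow> card (S \<omega> \<inter> U j))
          (I <+> J))"

definition Nsrc :: "real set \<Rightarrow> real \<Rightarrow> nat" where
  "Nsrc S z = card (S \<inter> {0<..z})"

definition ne_chain :: "(real \<times> real) list \<Rightarrow> bool" where
  "ne_chain xs \<longleftrightarrow> sorted_wrt (\<lambda>p q. fst p < fst q \<and> snd p < snd q) xs"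

definition Alen :: "(real \<times> real) set \<Rightarrow> real \<Rightarrow> real \<Rightarrow> nat" where
  "Alen P t z = Sup {length xs | xs. set xs \<subseteq> P \<inter> ({z<..t} \<times> {0<..t}) \<and> ne_chain xs}"

definition outer_prob :: "'a measure \<Rightarrow> 'a set \<Rightarrow> real" where
  "outer_prob M E = (INF A \<in> {A \<in> sets M. E \<inter> space M \<subseteq> A}. measure M A)"

end

theory Submission
  imports Defs "HOL-Real_Asymp.Real_Asymp"
begin

text \<open>
  Cut \<open>(0,t]\<^sup>2\<close> into small square cells. Up to an event whose probability vanishes with the mesh,
  longest chains of points are longest strictly increasing chains of occupied cells, and the
  resulting Bernoulli model, with added sources on one side and sinks on another, has an exact
  Burke property. Take source intensity \<open>\<lambda> = exp (- s)\<close> and sink intensity \<open>exp s\<close> with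
  \<open>s = r t\<^bsup>-1/3\<^esup>\<close>. By attractiveness, if the best path through the sinks beats the best path
  through the sources, the increments \<open>A\<^sub>t(0) - A\<^sub>t(z)\<close> dominate a Poisson process of intensity
  \<open>\<lambda>\<close>. Hence \<open>N(z) + A\<^sub>t(z) - A\<^sub>t(0)\<close> is at most a random walk with drift of order \<open>r \<epsilon> t\<^bsup>1/3\<^esup>\<close>
  and variance of order \<open>\<epsilon> t\<^bsup>2/3\<^esup>\<close> over the whole range, and for \<open>r = L / (2 \<epsilon>)\<close> its maximum exceeds
  \<open>L t\<^bsup>1/3\<^esup>\<close> with probability at most \<open>exp (- L\<^sup>2 / (16 \<epsilon>))\<close> in the limit. The sources win only with
  probability of order \<open>exp (- r\<^sup>3 / 8)\<close>: with source intensity \<open>exp (- a)\<close> and sink intensity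
  \<open>exp (- b)\<close> the last-passage value \<open>V\<close> satisfies
  \<open>E (exp ((a + b) V)) = exp (2 t (sinh a + sinh b))\<close>, which gives upper tails for \<open>a + b > 0\<close> and
  lower tails for \<open>a + b < 0\<close>.
\<close>

section \<open>Finite expectations\<close>

text \<open>Expectations are handled as functionals given by finite sums of weights over a support,
  which makes Fubini and integrability unconditional.\<close>

definition mean_on :: "'a set \<Rightarrow> (('a \<Rightarrow> real) \<Rightarrow> real) \<Rightarrow> bool" where
  "mean_on A E \<longleftrightarrow> finite A \<and>
     (\<exists>w. (\<forall>x\<in>A. 0 \<le> w x) \<and> sum w A = 1 \<and> (\<forall>f. E f = (\<Sum>x\<in>A. w x * f x)))"

definition bern :: "real \<Rightarrow> (bool \<Rightarrow> real) \<Rightarrow> real" where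
  "bern p f = p * f True + (1 - p) * f False"

text \<open>The product expectation is written as an iterated one, so that laws of rows and of whole
  fields yield to induction on lists; iterating \<open>bits\<close> gives independent rows.\<close>

primrec iid :: "(('a \<Rightarrow> real) \<Rightarrow> real) \<Rightarrow> nat \<Rightarrow> ('a list \<Rightarrow> real) \<Rightarrow> real" where
  "iid E 0 f = f []"
| "iid E (Suc n) f = E (\<lambda>x. iid E n (\<lambda>xs. f (x # xs)))"

abbreviation lists_of :: "'a set \<Rightarrow> nat \<Rightarrow> 'a list set" where
  "lists_of A n \<equiv> {xs. set xs \<subseteq> A \<and> length xs = n}"

lemma mean_on_mono:
  assumes "mean_on A E" "\<And>x. x \<in> A \<Longrightarrow> f x \<le> g x"
  shows "E f \<le> E g"
  using assms unfolding mean_on_def by (auto intro!: sum_mono mult_left_mono)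

lemma mean_on_add: "mean_on A E \<Longrightarrow> E (\<lambda>x. f x + g x) = E f + E g"
  unfolding mean_on_def by (auto simp: sum.distrib distrib_left)

lemma mean_on_cmult: "mean_on A E \<Longrightarrow> E (\<lambda>x. c * f x) = c * E f"
  unfolding mean_on_def by (auto simp: sum_distrib_left mult_ac intro!: sum.cong)

lemma mean_on_const: "mean_on A E \<Longrightarrow> E (\<lambda>x. c) = c"
  unfolding mean_on_def by (auto simp flip: sum_distrib_right)

lemma mean_on_swap:
  assumes "mean_on A E" "mean_on B F"
  shows "E (\<lambda>x. F (\<lambda>y. f x y)) = F (\<lambda>y. E (\<lambda>x. f x y))"
proof -
  obtain w where w: "\<And>f. E f = (\<Sum>x\<in>A. w x * f x)"
    using assms(1) unfolding mean_on_def by blast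
  obtain v where v: "\<And>f. F f = (\<Sum>x\<in>B. v x * f x)"
    using assms(2) unfolding mean_on_def by blast
  show ?thesis
    unfolding w v sum_distrib_left by (subst sum.swap) (simp add: mult_ac)
qed

lemma mean_on_bern: "0 \<le> p \<Longrightarrow> p \<le> 1 \<Longrightarrow> mean_on UNIV (bern p)"
  unfolding mean_on_def bern_def UNIV_bool
  by (auto intro!: exI[of _ "\<lambda>b. if b then p else 1 - p"])

lemma lists_of_Suc: "lists_of A (Suc n) = (\<lambda>(x, xs). x # xs) ` (A \<times> lists_of A n)"
proof (intro set_eqI iffI)
  fix ys assume "ys \<in> lists_of A (Suc n)"
  then show "ys \<in> (\<lambda>(x, xs). x # xs) ` (A \<times> lists_of A n)"
    by (cases ys) force+
qed auto

lemma sum_lists_of_Suc: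
  fixes g :: "'a list \<Rightarrow> real"
  assumes "finite A"
  shows "sum g (lists_of A (Suc n)) = (\<Sum>x\<in>A. \<Sum>xs\<in>lists_of A n. g (x # xs))"
proof -
  have "inj_on (\<lambda>(x, xs). x # xs) (A \<times> lists_of A n)"
    by (auto simp: inj_on_def)
  then have "sum g (lists_of A (Suc n)) = (\<Sum>(x, xs)\<in>A \<times> lists_of A n. g (x # xs))"
    unfolding lists_of_Suc by (subst sum.reindex) (auto intro!: sum.cong)
  then show ?thesis
    by (simp add: sum.cartesian_product)
qed

lemma iid_eq_sum:
  assumes "finite A" "\<And>f. E f = (\<Sum>x\<in>A. w x * f x)"
  shows "iid E n f = (\<Sum>xs\<in>lists_of A n. prod_list (map w xs) * f xs)"
proof (induction n arbitrary: f)
  case 0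
  have "lists_of A 0 = {[]}" by auto
  then show ?case by simp
next
  case (Suc n)
  have "iid E (Suc n) f = (\<Sum>x\<in>A. w x * iid E n (\<lambda>xs. f (x # xs)))"
    by (simp, subst assms(2)) simp
  then show ?case
    unfolding sum_lists_of_Suc[OF assms(1)] Suc
    by (simp add: sum_distrib_left mult_ac)
qed

lemma mean_on_iid:
  assumes "mean_on A E"
  shows "mean_on (lists_of A n) (iid E n)"
proof -
  obtain w where fin: "finite A" and w: "\<forall>x\<in>A. 0 \<le> w x" "sum w A = 1"
      "\<And>f. E f = (\<Sum>x\<in>A. w x * f x)"
    using assms unfolding mean_on_def by blast
  have "(\<Sum>xs\<in>lists_of A n. prod_list (map w xs)) = 1"
  proof (induction n)
    case 0
    have "lists_of A 0 = {[]}" by auto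
    then show ?case by simp
  next
    case (Suc n)
    then show ?case
      unfolding sum_lists_of_Suc[OF fin] using w(2) by (simp flip: sum_distrib_left)
  qed
  moreover have "0 \<le> prod_list (map w xs)" if "xs \<in> lists_of A n" for xs
    using that w(1) by (intro prod_list_nonneg) auto
  ultimately show ?thesis
    unfolding mean_on_def using iid_eq_sum[OF fin w(3)] finite_lists_length_eq[OF fin]
    by (auto intro!: exI[of _ "\<lambda>xs. prod_list (map w xs)"])
qed

abbreviation bits :: "real \<Rightarrow> nat \<Rightarrow> (bool list \<Rightarrow> real) \<Rightarrow> real" where
  "bits p \<equiv> iid (bern p)"

lemma mean_on_bits: "0 \<le> p \<Longrightarrow> p \<le> 1 \<Longrightarrow> mean_on (lists_of UNIV n) (bits p n)"
  by (rule mean_on_iid[OF mean_on_bern])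

lemma bits_Suc:
  "bits p (Suc n) f = p * bits p n (\<lambda>xs. f (True # xs)) + (1 - p) * bits p n (\<lambda>xs. f (False # xs))"
  by (simp, subst bern_def) simp

lemma bits_cmult: "bits p n (\<lambda>xs. c * f xs) = c * bits p n f"
proof (induction n arbitrary: f)
  case (Suc n)
  show ?case unfolding bits_Suc Suc by (simp add: algebra_simps)
qed simp

abbreviation bitrows :: "real \<Rightarrow> nat \<Rightarrow> nat \<Rightarrow> (bool list list \<Rightarrow> real) \<Rightarrow> real" where
  "bitrows p n m \<equiv> iid (bits p n) m"

lemma mean_on_bitrows:
  "0 \<le> p \<Longrightarrow> p \<le> 1 \<Longrightarrow> mean_on (lists_of (lists_of UNIV n) m) (bitrows p n m)"
  by (rule mean_on_iid[OF mean_on_bits])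

section \<open>The discrete Hammersley process\<close>

abbreviation ones :: "bool list \<Rightarrow> nat" where
  "ones xs \<equiv> count_list xs True"

text \<open>The discrete Hammersley process on a grid of cells, run from the top right corner so that
  list order is the order of columns (in a row) and of rows (in a field). A bit list records the
  0/1 increments of the last-passage values along a row: \<open>us\<close> are the sources on the top side,
  \<open>vs\<close> the sinks on the right side and \<open>rs\<close> the occupied cells. With increments \<open>u\<close>, \<open>w\<close> and
  occupation \<open>a\<close> at a cell, the outgoing increments are \<open>max u w a - w\<close> and \<open>max u w a - u\<close>.\<close>

fun rowstep :: "bool list \<Rightarrow> bool \<Rightarrow> bool list \<Rightarrow> bool list \<times> bool" where
  "rowstep (u # us) v (a # as) =
     (let (us', w) = rowstep us v as in (((u \<or> a) \<and> \<not> w) # us', (w \<or> a) \<and> \<not> u))"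
| "rowstep _ v _ = ([], v)"

text \<open>\<open>us\<close> enters above the last row of the list and the first row is processed
  last, so the result is the row of increments along the bottom side of the field. Without sources
  and sinks its initial segments count the discrete analogue of A_t(0) - A_t(z).\<close>

fun top_row :: "bool list \<Rightarrow> bool list \<Rightarrow> bool list list \<Rightarrow> bool list" where
  "top_row us (v # vs) (r # rs) = fst (rowstep (top_row us vs rs) v r)"
| "top_row us _ _ = us"

text \<open>The last-passage value from the top right to the bottom left corner, summed down the
  right side and then along the bottom side.\<close>

definition lpp :: "bool list \<Rightarrow> bool list \<Rightarrow> bool list list \<Rightarrow> nat" where
  "lpp us vs rs = ones vs + ones (top_row us vs rs)"

lemma length_rowstep: "length us = length as \<Longrightarrow> length (fst (rowstep us v as)) = length us"
  by (induction us v as rule: rowstep.induct) (auto simp: Let_def split: prod.splits)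

lemma length_top_row:
  "rs \<in> lists_of (lists_of UNIV (length us)) m \<Longrightarrow> length (top_row us vs rs) = length us"
  by (induction us vs rs arbitrary: m rule: top_row.induct) (auto simp: length_rowstep)

text \<open>Burke's property: the product law of the two incoming increments is preserved by a cell
  exactly when the product of their odds is the occupation probability.\<close>

lemma bern_burke:
  assumes "(1 - a) * (1 - b) * p = a * b"
  shows "bern a (\<lambda>u. bern b (\<lambda>w. bern p (\<lambda>x. g ((u \<or> x) \<and> \<not> w) ((w \<or> x) \<and> \<not> u))))
       = bern a (\<lambda>u. bern b (\<lambda>w. g u w))"
proof -
  have "bern a (\<lambda>u. bern b (\<lambda>w. bern p (\<lambda>x. g ((u \<or> x) \<and> \<not> w) ((w \<or> x) \<and> \<not> u))))
     = a * b * g False False + a * (1 - b) * g True False + (1 - a) * b * g False True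
       + ((1 - a) * (1 - b) * p) * g True True
       + ((1 - a) * (1 - b) - ((1 - a) * (1 - b) * p)) * g False False"
    unfolding bern_def by (simp add: algebra_simps)
  also have "\<dots> = bern a (\<lambda>u. bern b (\<lambda>w. g u w))"
    unfolding assms bern_def by (simp add: algebra_simps)
  finally show ?thesis .
qed

text \<open>The columns to the right come first. By induction they leave a stationary row and an
  independent sink increment \<open>w\<close>, to which \<open>bern_burke\<close> applies at the
  head cell; the swaps only reorder independent expectations.\<close>

lemma rowstep_burke:
  assumes ab: "(1 - a) * (1 - b) * p = a * b"
    and a: "0 \<le> a" "a \<le> 1" and b: "0 \<le> b" "b \<le> 1" and p: "0 \<le> p" "p \<le> 1"
  shows "bits a n (\<lambda>us. bern b (\<lambda>v. bits p n (\<lambda>as. f (rowstep us v as))))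
       = bits a n (\<lambda>us. bern b (\<lambda>v. f (us, v)))"
proof (induction n arbitrary: f)
  case 0
  show ?case by simp
next
  case (Suc n)
  note A = mean_on_bern[OF a] and B = mean_on_bern[OF b] and P = mean_on_bern[OF p]
  note An = mean_on_bits[OF a, of n] and Pn = mean_on_bits[OF p, of n]
  define F where "F u x = (\<lambda>(us', w). f (((u \<or> x) \<and> \<not> w) # us', (w \<or> x) \<and> \<not> u))" for u x
  have "bits a (Suc n) (\<lambda>us. bern b (\<lambda>v. bits p (Suc n) (\<lambda>as. f (rowstep us v as))))
      = bern a (\<lambda>u. bits a n (\<lambda>us. bern b (\<lambda>v. bern p (\<lambda>x. bits p n (\<lambda>as.
          F u x (rowstep us v as))))))"
    by (simp add: F_def Let_def case_prod_beta)
  also have "\<dots> = bern a (\<lambda>u. bits a n (\<lambda>us. bern p (\<lambda>x. bern b (\<lambda>v. bits p n (\<lambda>as.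
          F u x (rowstep us v as))))))"
    by (subst mean_on_swap[OF B P]) simp
  also have "\<dots> = bern a (\<lambda>u. bern p (\<lambda>x. bits a n (\<lambda>us. bern b (\<lambda>v. bits p n (\<lambda>as.
          F u x (rowstep us v as))))))"
    by (subst mean_on_swap[OF An P]) simp
  also have "\<dots> = bern a (\<lambda>u. bern p (\<lambda>x. bits a n (\<lambda>us. bern b (\<lambda>w. F u x (us, w)))))"
    by (simp only: Suc)
  also have "\<dots> = bern a (\<lambda>u. bits a n (\<lambda>us. bern p (\<lambda>x. bern b (\<lambda>w. F u x (us, w)))))"
    by (subst mean_on_swap[OF P An]) simp
  also have "\<dots> = bern a (\<lambda>u. bits a n (\<lambda>us. bern b (\<lambda>w. bern p (\<lambda>x. F u x (us, w)))))"
    by (subst mean_on_swap[OF P B]) simp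
  also have "\<dots> = bits a n (\<lambda>us. bern a (\<lambda>u. bern b (\<lambda>w. bern p (\<lambda>x. F u x (us, w)))))"
    by (subst mean_on_swap[OF A An]) simp
  also have "\<dots> = bits a n (\<lambda>us. bern a (\<lambda>u. bern b (\<lambda>w. f (u # us, w))))"
    unfolding F_def case_prod_conv
    by (subst bern_burke[OF ab, where g = "\<lambda>u w. f (u # _, w)"]) simp
  also have "\<dots> = bern a (\<lambda>u. bits a n (\<lambda>us. bern b (\<lambda>w. f (u # us, w))))"
    by (subst mean_on_swap[OF A An]) simp
  finally show ?case by simp
qed

text \<open>By induction the rows above the first one leave a stationary row, and
  \<open>rowstep_burke\<close> carries it through the first row once the outgoing sink is
  discarded.\<close>

lemma top_row_burke:
  assumes ab: "(1 - a) * (1 - b) * p = a * b"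
    and a: "0 \<le> a" "a \<le> 1" and b: "0 \<le> b" "b \<le> 1" and p: "0 \<le> p" "p \<le> 1"
  shows "bits a n (\<lambda>us. bits b m (\<lambda>vs. bitrows p n m (\<lambda>rs. f (top_row us vs rs)))) = bits a n f"
proof (induction m arbitrary: f)
  case 0
  show ?case by simp
next
  case (Suc m)
  note A = mean_on_bits[OF a, of n] and B = mean_on_bern[OF b] and P = mean_on_bits[OF p, of n]
  note Bm = mean_on_bits[OF b, of m] and Pm = mean_on_bitrows[OF p, of n m]
  have "bits a n (\<lambda>us. bits b (Suc m) (\<lambda>vs. bitrows p n (Suc m) (\<lambda>rs. f (top_row us vs rs))))
     = bits a n (\<lambda>us. bern b (\<lambda>v. bits b m (\<lambda>vs. bits p n (\<lambda>r. bitrows p n m (\<lambda>rs.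
          f (fst (rowstep (top_row us vs rs) v r)))))))"
    by simp
  also have "\<dots> = bits a n (\<lambda>us. bits b m (\<lambda>vs. bern b (\<lambda>v. bitrows p n m (\<lambda>rs. bits p n (\<lambda>r.
          f (fst (rowstep (top_row us vs rs) v r)))))))"
    by (subst mean_on_swap[OF B Bm], subst mean_on_swap[OF P Pm]) simp
  also have "\<dots> = bits a n (\<lambda>us. bits b m (\<lambda>vs. bitrows p n m (\<lambda>rs. bern b (\<lambda>v. bits p n (\<lambda>r.
          f (fst (rowstep (top_row us vs rs) v r)))))))"
    by (subst mean_on_swap[OF B Pm]) simp
  also have "\<dots> = bits a n (\<lambda>us. bern b (\<lambda>v. bits p n (\<lambda>r. f (fst (rowstep us v r)))))"
    by (rule Suc[where f = "\<lambda>t. bern b (\<lambda>v. bits p n (\<lambda>r. f (fst (rowstep t v r))))"])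
  also have "\<dots> = bits a n (\<lambda>us. bern b (\<lambda>v. f us))"
    using rowstep_burke[OF ab a b p, of n "\<lambda>x. f (fst x)"] by simp
  finally show ?case
    by (simp add: mean_on_const[OF B])
qed

section \<open>Exponential moments of the last-passage value\<close>

lemma bits_tilt:
  assumes "b' * exp c = \<kappa> * b" "1 - b' = \<kappa> * (1 - b)"
  shows "bits b' m (\<lambda>vs. exp (c * real (ones vs)) * f vs) = \<kappa> ^ m * bits b m f"
proof (induction m arbitrary: f)
  case 0
  show ?case by simp
next
  case (Suc m)
  have "bits b' (Suc m) (\<lambda>vs. exp (c * real (ones vs)) * f vs)
     = b' * bits b' m (\<lambda>vs. exp (c * real (ones vs)) * (exp c * f (True # vs)))
       + (1 - b') * bits b' m (\<lambda>vs. exp (c * real (ones vs)) * f (False # vs))"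
    unfolding bits_Suc by (simp add: distrib_left exp_add mult_ac)
  also have "\<dots> = b' * (\<kappa> ^ m * bits b m (\<lambda>vs. exp c * f (True # vs)))
       + (1 - b') * (\<kappa> ^ m * bits b m (\<lambda>vs. f (False # vs)))"
    by (simp only: Suc)
  also have "bits b m (\<lambda>vs. exp c * f (True # vs)) = exp c * bits b m (\<lambda>vs. f (True # vs))"
    by (rule bits_cmult)
  also have "b' * (\<kappa> ^ m * (exp c * bits b m (\<lambda>vs. f (True # vs))))
      = (b' * exp c) * (\<kappa> ^ m * bits b m (\<lambda>vs. f (True # vs)))"
    by simp
  finally show ?case
    unfolding assms bits_Suc by (simp add: algebra_simps)
qed

lemma bits_exp_ones:
  "bits a n (\<lambda>us. exp (c * real (ones us))) = (1 - a + a * exp c) ^ n"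
proof (induction n)
  case 0
  show ?case by simp
next
  case (Suc n)
  have "bits a (Suc n) (\<lambda>us. exp (c * real (ones us)))
     = a * bits a n (\<lambda>us. exp c * exp (c * real (ones us)))
       + (1 - a) * bits a n (\<lambda>us. exp (c * real (ones us)))"
    unfolding bits_Suc by (simp add: distrib_left exp_add)
  then show ?case
    unfolding bits_cmult Suc by (simp add: algebra_simps)
qed

lemma mean_on_prod:
  assumes "mean_on A E" "mean_on B F"
  shows "mean_on (A \<times> B) (\<lambda>f. E (\<lambda>x. F (\<lambda>y. f (x, y))))"
proof -
  obtain w where w: "finite A" "\<forall>x\<in>A. 0 \<le> w x" "sum w A = 1" "\<And>f. E f = (\<Sum>x\<in>A. w x * f x)"
    using assms(1) unfolding mean_on_def by blast
  obtain v where v: "finite B" "\<forall>x\<in>B. 0 \<le> v x" "sum v B = 1" "\<And>f. F f = (\<Sum>x\<in>B. v x * f x)"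
    using assms(2) unfolding mean_on_def by blast
  have "(\<Sum>z\<in>A \<times> B. w (fst z) * v (snd z)) = 1"
    using w(3) v(3) sum_product[of w A v B] by (simp add: sum.cartesian_product case_prod_beta)
  then show ?thesis
    unfolding mean_on_def w(4) v(4) using w(1,2) v(1,2)
    by (auto intro!: exI[of _ "\<lambda>z. w (fst z) * v (snd z)"]
        simp: sum_distrib_left sum.cartesian_product case_prod_beta mult_ac)
qed

text \<open>Odds are the convenient parameter: stationarity fixes the product of two odds, and
  exponential tilting multiplies odds.\<close>

definition of_odds :: "real \<Rightarrow> real" where
  "of_odds x = x / (1 + x)"

lemma of_odds_bounds: "0 \<le> x \<Longrightarrow> 0 \<le> of_odds x" "0 \<le> x \<Longrightarrow> of_odds x \<le> 1"
  by (auto simp: of_odds_def)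

lemma one_minus_of_odds: "0 \<le> x \<Longrightarrow> 1 - of_odds x = 1 / (1 + x)"
  by (auto simp: of_odds_def field_simps)

definition field_mean ::
    "real \<Rightarrow> nat \<Rightarrow> real \<Rightarrow> real \<Rightarrow> (bool list \<times> bool list \<times> bool list list \<Rightarrow> real) \<Rightarrow> real" where
  "field_mean p n x y f = bits (of_odds x) n (\<lambda>us. bits (of_odds y) n (\<lambda>vs.
     bitrows p n n (\<lambda>rs. f (us, vs, rs))))"

abbreviation fields :: "nat \<Rightarrow> (bool list \<times> bool list \<times> bool list list) set" where
  "fields n \<equiv> lists_of UNIV n \<times> lists_of UNIV n \<times> lists_of (lists_of UNIV n) n"

lemma mean_on_field_mean:
  assumes "0 \<le> x" "0 \<le> y" "0 \<le> p" "p \<le> 1"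
  shows "mean_on (fields n) (field_mean p n x y)"
  unfolding field_mean_def using assms
  by (intro mean_on_prod mean_on_bits mean_on_bitrows of_odds_bounds) auto

text \<open>The factor that each of the two boundary parameters contributes to the exponential
  moment of the corner value; for \<open>q\<close> close to \<open>t / n\<close> it approximates
  \<open>exp (2 * t * sinh a)\<close>.\<close>

definition tilt :: "real \<Rightarrow> nat \<Rightarrow> real \<Rightarrow> real" where
  "tilt q n a = ((1 + q * exp a) / (1 + q * exp (- a))) ^ n"

text \<open>Tilting the sinks by \<open>exp ((a + b) * ones vs)\<close> turns their odds \<open>q * exp (- b)\<close> into the
  stationary \<open>q * exp a\<close>; what remains of the exponential is a function of the top row,
  whose law is known by Burke's property.\<close>

lemma lpp_mgf:
  assumes q: "0 < q" "q \<le> 1"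
  shows "field_mean (q\<^sup>2) n (q * exp (- a)) (q * exp (- b))
      (\<lambda>(us, vs, rs). exp ((a + b) * real (lpp us vs rs))) = tilt q n a * tilt q n b"
proof -
  define x y y' where "x = q * exp (- a)" and "y = q * exp a" and "y' = q * exp (- b)"
  have pos: "0 < x" "0 < y" "0 < y'" using q by (auto simp: x_def y_def y'_def)
  have xy: "x * y = q\<^sup>2"
    by (simp add: x_def y_def power2_eq_square mult.assoc flip: exp_add)
  have p: "0 \<le> q\<^sup>2" "q\<^sup>2 \<le> 1" using q by (auto simp: power_le_one)
  \<comment> \<open>The normalising constant per bit: tilting the Bernoulli weights of odds
    \<open>y'\<close> gives \<kappa> times those of odds \<open>y\<close>.\<close>
  define \<kappa> where "\<kappa> = (1 + y) / (1 + y')"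
  have burke: "(1 - of_odds x) * (1 - of_odds y) * q\<^sup>2 = of_odds x * of_odds y"
    using pos by (simp add: one_minus_of_odds xy[symmetric]) (simp add: of_odds_def)
  have "y' * exp (a + b) = y"
    by (simp add: y'_def y_def mult.assoc flip: exp_add)
  then have tilt1: "of_odds y' * exp (a + b) = \<kappa> * of_odds y"
    using pos by (simp add: of_odds_def \<kappa>_def)
  have tilt2: "1 - of_odds y' = \<kappa> * (1 - of_odds y)"
    using pos by (simp add: one_minus_of_odds \<kappa>_def field_simps)
  have "field_mean (q\<^sup>2) n x y' (\<lambda>(us, vs, rs). exp ((a + b) * real (lpp us vs rs)))
     = bits (of_odds x) n (\<lambda>us. bits (of_odds y') n (\<lambda>vs. exp ((a + b) * real (ones vs)) *
         bitrows (q\<^sup>2) n n (\<lambda>rs. exp ((a + b) * real (ones (top_row us vs rs))))))"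
    unfolding field_mean_def
    by (simp add: lpp_def distrib_left exp_add mean_on_cmult[OF mean_on_bitrows[OF p]])
  also have "\<dots> = bits (of_odds x) n (\<lambda>us. \<kappa> ^ n * bits (of_odds y) n (\<lambda>vs.
         bitrows (q\<^sup>2) n n (\<lambda>rs. exp ((a + b) * real (ones (top_row us vs rs))))))"
    by (subst bits_tilt[OF tilt1 tilt2]) simp
  also have "\<dots> = \<kappa> ^ n * bits (of_odds x) n (\<lambda>us. bits (of_odds y) n (\<lambda>vs.
         bitrows (q\<^sup>2) n n (\<lambda>rs. exp ((a + b) * real (ones (top_row us vs rs))))))"
    by (rule bits_cmult)
  also have "\<dots> = \<kappa> ^ n * bits (of_odds x) n (\<lambda>us. exp ((a + b) * real (ones us)))"
    using pos by (subst top_row_burke[OF burke _ _ _ _ p, where f = "\<lambda>t. exp ((a + b) * real (ones t))"])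
      (auto intro: of_odds_bounds)
  also have "\<dots> = \<kappa> ^ n * (1 - of_odds x + of_odds x * exp (a + b)) ^ n"
    by (simp add: bits_exp_ones)
  also have "1 - of_odds x + of_odds x * exp (a + b) = (1 + q * exp b) / (1 + x)"
  proof -
    have "x * exp (a + b) = q * exp b"
      by (simp add: x_def mult.assoc flip: exp_add)
    then show ?thesis
      using pos by (simp add: one_minus_of_odds) (simp add: of_odds_def add_divide_distrib)
  qed
  also have "\<kappa> ^ n * ((1 + q * exp b) / (1 + x)) ^ n = tilt q n a * tilt q n b"
    unfolding tilt_def \<kappa>_def by (simp add: x_def y_def y'_def mult_ac flip: power_mult_distrib)
  finally show ?thesis by (simp add: x_def y'_def)
qed

section \<open>Last-passage recursion and the two-sided maximum\<close>

lemma rowstep_conserve: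
  "length us = length as \<Longrightarrow>
    of_bool (snd (rowstep us v as)) + ones us = of_bool v + ones (fst (rowstep us v as))"
  by (induction us v as rule: rowstep.induct) (auto simp: Let_def split: prod.splits)

text \<open>Values are measured from the top right corner of the row. By
  \<open>rowstep_conserve\<close> both boundary paths of the old row give the same value at its far
  corner, so the new corner takes the maximum over the right neighbour, the upper neighbour and the
  diagonal through the new cell.\<close>

lemma rowstep_Cons_max:
  assumes "length us = length as"
  shows "of_bool v + ones (fst (rowstep (u # us) v (a # as))) =
    max (of_bool v + ones (fst (rowstep us v as))) (max (ones (u # us)) (ones us + of_bool a))"
  using rowstep_conserve[OF assms, of v] by (auto simp: Let_def split: prod.splits)

lemma drop_rowstep:
  "drop k (fst (rowstep us v as)) = fst (rowstep (drop k us) v (drop k as))"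
proof (induction us v as arbitrary: k rule: rowstep.induct)
  case (1 u us v a as)
  then show ?case by (cases k) (auto simp: Let_def split: prod.splits)
qed auto

text \<open>Information travels only leftwards, so removing the first \<open>k\<close> columns does
  not disturb the other increments. One row thus encodes the values for all starting points at
  once.\<close>

lemma drop_top_row:
  "drop k (top_row us vs rs) = top_row (drop k us) vs (map (drop k) rs)"
  by (induction us vs rs rule: top_row.induct) (auto simp: drop_rowstep)

lemma lpp_Cons:
  assumes "length as = length us" "rs \<in> lists_of (lists_of UNIV (Suc (length us))) m"
  shows "lpp (u # us) (v # vs) ((a # as) # rs) = max (lpp us (v # vs) (as # map tl rs))
    (max (lpp (u # us) vs rs) (lpp us vs (map tl rs) + of_bool a))"
proof -
  have len: "length (top_row (u # us) vs rs) = Suc (length us)"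
    using length_top_row[of rs "u # us" m] assms by simp
  then obtain t ts where t: "top_row (u # us) vs rs = t # ts"
    by (cases "top_row (u # us) vs rs") auto
  have "drop 1 (top_row (u # us) vs rs) = top_row us vs (map tl rs)"
    unfolding drop_top_row by (simp add: drop_Suc[abs_def])
  then have ts: "ts = top_row us vs (map tl rs)" by (simp add: t)
  have "length ts = length as" using len t assms by simp
  from rowstep_Cons_max[OF this, of v t a] show ?thesis
    unfolding lpp_def by (auto simp: t ts[symmetric] max_def simp del: rowstep.simps)
qed

abbreviation zeros :: "nat \<Rightarrow> bool list" where
  "zeros n \<equiv> replicate n False"

lemma ones_zeros: "ones (zeros n) = 0"
  by (induction n) auto

lemma lpp_Nil: "rs \<in> lists_of (lists_of UNIV 0) m \<Longrightarrow> lpp [] vs rs = ones vs"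
  using length_top_row[of rs "[]" m vs] by (simp add: lpp_def)

lemma lists_of_tl:
  "rs \<in> lists_of (lists_of UNIV (Suc n)) m \<Longrightarrow> map tl rs \<in> lists_of (lists_of UNIV n) m"
  by (auto simp: subset_iff)

text \<open>A directed path can collect points on only one of the two sides. Formally, both sides of
  the equation obey the recursion \<open>lpp_Cons\<close>, since adding the weight of a cell
  commutes with \<open>max\<close>; the outer induction removes a row, the inner one a
  column.\<close>

lemma lpp_eq_max:
  "rs \<in> lists_of (lists_of UNIV (length us)) (length vs) \<Longrightarrow>
    lpp us vs rs = max (lpp us (zeros (length vs)) rs) (lpp (zeros (length us)) vs rs)"
proof (induction vs arbitrary: us rs)
  case Nil
  then show ?case by (simp add: lpp_def ones_zeros)
next
  case (Cons v vs)
  note IH = Cons.IH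
  from Cons.prems show ?case
  proof (induction us arbitrary: rs)
    case Nil
    then show ?case by (simp add: lpp_Nil[where m = "Suc (length vs)"] ones_zeros del: replicate_Suc)
  next
    case (Cons u us)
    obtain a as rs' where rs: "rs = (a # as) # rs'" and as: "length as = length us"
      and rs': "rs' \<in> lists_of (lists_of UNIV (Suc (length us))) (length vs)"
      using Cons.prems by (cases rs; cases "hd rs") auto
    have tl: "map tl rs' \<in> lists_of (lists_of UNIV (length us)) (length vs)"
      using lists_of_tl[OF rs'] .
    have 1: "lpp us (v # vs) (as # map tl rs') =
       max (lpp us (zeros (length (v # vs))) (as # map tl rs')) (lpp (zeros (length us)) (v # vs) (as # map tl rs'))"
      by (rule Cons.IH) (use tl as in auto)
    have 2: "lpp (u # us) vs rs' =
       max (lpp (u # us) (zeros (length vs)) rs') (lpp (zeros (length (u # us))) vs rs')"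
      by (rule IH) (use rs' in auto)
    have 3: "lpp us vs (map tl rs') =
       max (lpp us (zeros (length vs)) (map tl rs')) (lpp (zeros (length us)) vs (map tl rs'))"
      by (rule IH) (use tl in auto)
    have as': "length as = length (zeros (length us))"
      and rs'': "rs' \<in> lists_of (lists_of UNIV (Suc (length (zeros (length us))))) (length vs)"
      using as rs' by auto
    show ?case
      unfolding rs lpp_Cons[OF as rs'] 1 2 3 length_Cons replicate_Suc lpp_Cons[OF as' rs'']
      by (simp only: max_add_distrib_left max.assoc max.commute max.left_commute)
  qed
qed

section \<open>Attractiveness and comparison of increments\<close>

lemma rowstep_attractive:
  assumes "list_all2 (\<le>) us' us" "v \<le> v'" "length us = length as"
  shows "list_all2 (\<le>) (fst (rowstep us' v' as)) (fst (rowstep us v as))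
    \<and> snd (rowstep us v as) \<le> snd (rowstep us' v' as)"
  using assms
proof (induction us v as arbitrary: us' rule: rowstep.induct)
  case (1 u us v a as)
  obtain u' us'' where u: "us' = u' # us''" "u' \<le> u" "list_all2 (\<le>) us'' us"
    using 1(2) by (metis list_all2_Cons2)
  show ?case
    using 1(1)[OF u(3) 1(3)] 1(4) u by (auto simp: Let_def split: prod.splits)
qed auto

lemma top_row_attractive:
  assumes "list_all2 (\<le>) us' us" "list_all2 (\<le>) vs vs'"
    "rs \<in> lists_of (lists_of UNIV (length us)) m"
  shows "list_all2 (\<le>) (top_row us' vs' rs) (top_row us vs rs)"
  using assms
proof (induction us vs rs arbitrary: vs' m rule: top_row.induct)
  case (1 us v vs r rs)
  obtain v' vs'' where v: "vs' = v' # vs''" "v \<le> v'" "list_all2 (\<le>) vs vs''"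
    using 1(3) by (metis list_all2_Cons1)
  have rs: "rs \<in> lists_of (lists_of UNIV (length us)) (length rs)" and r: "length r = length us"
    using 1(4) by auto
  have "list_all2 (\<le>) (top_row us' vs'' rs) (top_row us vs rs)"
    by (rule 1(1)[OF 1(2) v(3) rs])
  then show ?case
    unfolding v(1) top_row.simps using v(2) length_top_row[OF rs] r
    by (intro rowstep_attractive[THEN conjunct1]) auto
qed (auto simp: list_all2_Cons1)

lemma ones_mono: "list_all2 (\<le>) xs ys \<Longrightarrow> ones xs \<le> ones ys"
  by (induction xs ys rule: list_all2_induct) auto

lemma ones_take_drop: "ones (take k xs) + ones (drop k xs) = ones xs"
  by (metis append_take_drop_id count_list_append)

text \<open>When the sinks win, deleting the sources leaves the total value unchanged, while over
  the columns from \<open>k\<close> on it can only lower the value; so the first \<open>k\<close>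
  increments can only gain. Deleting the sinks as well raises every increment by
  attractiveness.\<close>

lemma ones_take_top_row_le:
  assumes us: "length us = n" and vs: "length vs = m"
    and rs: "rs \<in> lists_of (lists_of UNIV n) m"
    and win: "lpp us (zeros m) rs \<le> lpp (zeros n) vs rs"
  shows "ones (take k (top_row us vs rs)) \<le> ones (take k (top_row (zeros n) (zeros m) rs))"
proof -
  have drp: "map (drop k) rs \<in> lists_of (lists_of UNIV (n - k)) m"
    using rs by (auto simp: subset_iff)
  have eq: "lpp us vs rs = lpp (zeros n) vs rs"
    using lpp_eq_max[of rs us vs] us vs rs win by auto
  have "lpp (zeros (n - k)) vs (map (drop k) rs) \<le> lpp (drop k us) vs (map (drop k) rs)"
    using lpp_eq_max[of "map (drop k) rs" "drop k us" vs] us vs drp by auto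
  then have "ones (drop k (top_row (zeros n) vs rs)) \<le> ones (drop k (top_row us vs rs))"
    unfolding drop_top_row by (simp add: lpp_def)
  moreover have "ones (top_row us vs rs) = ones (top_row (zeros n) vs rs)"
    using eq by (simp add: lpp_def)
  ultimately have "ones (take k (top_row us vs rs)) \<le> ones (take k (top_row (zeros n) vs rs))"
    using ones_take_drop[of k "top_row us vs rs"] ones_take_drop[of k "top_row (zeros n) vs rs"]
    by linarith
  also have "list_all2 (\<le>) (zeros m) vs"
    using vs by (auto simp: list_all2_conv_all_nth)
  then have "list_all2 (\<le>) (top_row (zeros n) vs rs) (top_row (zeros n) (zeros m) rs)"
    using rs by (intro top_row_attractive[where m = m]) (auto simp: list.rel_refl)
  then have "ones (take k (top_row (zeros n) vs rs)) \<le> ones (take k (top_row (zeros n) (zeros m) rs))"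
    by (intro ones_mono list_all2_takeI)
  finally show ?thesis .
qed

section \<open>Exit side and maximal inequality\<close>

lemma field_mean_sinks_irrelevant:
  assumes "0 \<le> y" "0 \<le> y'"
  shows "field_mean p n x y (\<lambda>(us, vs, rs). f us rs) = field_mean p n x y' (\<lambda>(us, vs, rs). f us rs)"
  unfolding field_mean_def using assms
  by (simp add: mean_on_const[OF mean_on_bits[OF of_odds_bounds]])

lemma field_mean_sources_irrelevant:
  assumes "0 \<le> x" "0 \<le> x'"
  shows "field_mean p n x y (\<lambda>(us, vs, rs). f vs rs) = field_mean p n x' y (\<lambda>(us, vs, rs). f vs rs)"
  unfolding field_mean_def using assms
  by (simp add: mean_on_const[OF mean_on_bits[OF of_odds_bounds]])

text \<open>The three terms bound the probabilities that the source path with odds \<open>q * exp (- s)\<close>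
  exceeds \<open>l\<close>, that the corner value with source odds \<open>q * exp (- s / 2)\<close> and the same sinks
  stays below \<open>l\<close>, and that in this second process the source path exceeds \<open>l\<close>. With
  \<open>l = 2 * t + s\<^sup>2 * t / 3\<close> all three decay like \<open>exp (- s ^ 3 * t / 8)\<close> or faster.\<close>

definition exit_bound :: "real \<Rightarrow> nat \<Rightarrow> real \<Rightarrow> real \<Rightarrow> real" where
  "exit_bound q n s l = exp (- (s + s / 2) * l) * (tilt q n s * tilt q n (s / 2))
     + (exp (- (s / 2 + - s) * l) * (tilt q n (s / 2) * tilt q n (- s))
     + exp (- (s / 2 + s / 2) * l) * (tilt q n (s / 2) * tilt q n (s / 2)))"

context
  fixes q :: real
  assumes q: "0 < q" "q \<le> 1"
begin

lemma mean_on_field_mean_exp: "mean_on (fields n) (field_mean (q\<^sup>2) n (q * exp a) (q * exp b))"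
  using q by (intro mean_on_field_mean) (auto simp: power_le_one)

text \<open>Chernoff's bound. The source path does not see the sinks, so their odds may be reset to
  \<open>q * exp (- b)\<close>; it is at most the corner value, whose exponential moment is
  \<open>lpp_mgf\<close>.\<close>

lemma source_path_upper_tail:
  assumes "0 \<le> a + b" "0 \<le> y"
  shows "field_mean (q\<^sup>2) n (q * exp (- a)) y (\<lambda>(us, vs, rs). of_bool (l \<le> real (lpp us (zeros n) rs)))
    \<le> exp (- (a + b) * l) * (tilt q n a * tilt q n b)"
proof -
  let ?E = "field_mean (q\<^sup>2) n (q * exp (- a)) (q * exp (- b))"
  have "field_mean (q\<^sup>2) n (q * exp (- a)) y (\<lambda>(us, vs, rs). of_bool (l \<le> real (lpp us (zeros n) rs)))
     = ?E (\<lambda>(us, vs, rs). of_bool (l \<le> real (lpp us (zeros n) rs)))"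
    using q assms by (intro field_mean_sinks_irrelevant) auto
  also have "\<dots> \<le> ?E (\<lambda>z. exp (- (a + b) * l) * (case z of (us, vs, rs) \<Rightarrow> exp ((a + b) * real (lpp us vs rs))))"
  proof (rule mean_on_mono[OF mean_on_field_mean_exp], clarify)
    fix us vs :: "bool list" and rs :: "bool list list"
    assume n: "n = length us" "length vs = length us" "set rs \<subseteq> lists_of UNIV (length us)"
      "length rs = length us"
    have "lpp us (zeros (length us)) rs \<le> lpp us vs rs"
      using n lpp_eq_max[of rs us vs] by auto
    moreover have "1 \<le> exp (- (a + b) * l) * exp ((a + b) * real (lpp us vs rs))"
      if "l \<le> real (lpp us vs rs)"
      using mult_nonneg_nonneg[OF assms(1), of "real (lpp us vs rs) - l"] that
      by (simp add: algebra_simps flip: exp_add)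
    ultimately show "of_bool (l \<le> real (lpp us (zeros (length us)) rs))
        \<le> exp (- (a + b) * l) * exp ((a + b) * real (lpp us vs rs))"
      by (auto simp: of_bool_def)
  qed
  also have "\<dots> = exp (- (a + b) * l) * (tilt q n a * tilt q n b)"
    by (simp only: mean_on_cmult[OF mean_on_field_mean_exp] lpp_mgf[OF q, simplified])
  finally show ?thesis .
qed

lemma corner_lower_tail:
  assumes "a + b \<le> 0"
  shows "field_mean (q\<^sup>2) n (q * exp (- a)) (q * exp (- b)) (\<lambda>(us, vs, rs). of_bool (real (lpp us vs rs) < l))
    \<le> exp (- (a + b) * l) * (tilt q n a * tilt q n b)"
proof -
  let ?E = "field_mean (q\<^sup>2) n (q * exp (- a)) (q * exp (- b))"
  have "?E (\<lambda>(us, vs, rs). of_bool (real (lpp us vs rs) < l))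
     \<le> ?E (\<lambda>z. exp (- (a + b) * l) * (case z of (us, vs, rs) \<Rightarrow> exp ((a + b) * real (lpp us vs rs))))"
  proof (rule mean_on_mono[OF mean_on_field_mean_exp], clarify)
    fix us vs :: "bool list" and rs :: "bool list list"
    have "1 \<le> exp (- (a + b) * l) * exp ((a + b) * real (lpp us vs rs))"
      if "real (lpp us vs rs) < l"
      using mult_nonpos_nonpos[OF assms(1), of "real (lpp us vs rs) - l"] that
      by (simp add: algebra_simps flip: exp_add)
    then show "of_bool (real (lpp us vs rs) < l)
        \<le> exp (- (a + b) * l) * exp ((a + b) * real (lpp us vs rs))"
      by (auto simp: of_bool_def)
  qed
  also have "\<dots> = exp (- (a + b) * l) * (tilt q n a * tilt q n b)"
    by (simp only: mean_on_cmult[OF mean_on_field_mean_exp] lpp_mgf[OF q, simplified])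
  finally show ?thesis .
qed

text \<open>If the sources win, the source path reaches \<open>l\<close> or the sink path stays
  below \<open>l\<close>. In the stationary model the two parameters cancel and
  \<open>lpp_mgf\<close> says nothing, so the sink path is studied with source odds
  \<open>q * exp (- (s / 2))\<close>: there the corner value is below \<open>l\<close> or the source
  path reaches \<open>l\<close>.\<close>

lemma exit_probability:
  assumes s: "0 \<le> s"
  shows "field_mean (q\<^sup>2) n (q * exp (- s)) (q * exp s)
      (\<lambda>(us, vs, rs). of_bool (lpp (zeros n) vs rs < lpp us (zeros n) rs)) \<le> exit_bound q n s l"
proof -
  let ?E = "field_mean (q\<^sup>2) n (q * exp (- s)) (q * exp s)"
  let ?E' = "field_mean (q\<^sup>2) n (q * exp (- (s / 2))) (q * exp (- (- s)))"
  let ?src = "\<lambda>(us, vs, rs). of_bool (l \<le> real (lpp us (zeros n) rs)) :: real"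
  let ?snk = "\<lambda>(us, vs, rs). of_bool (real (lpp (zeros n) vs rs) < l) :: real"
  let ?cor = "\<lambda>(us, vs, rs). of_bool (real (lpp us vs rs) < l) :: real"
  have E: "mean_on (fields n) ?E" and E': "mean_on (fields n) ?E'"
    by (rule mean_on_field_mean_exp)+
  have "?E (\<lambda>(us, vs, rs). of_bool (lpp (zeros n) vs rs < lpp us (zeros n) rs))
      \<le> ?E (\<lambda>z. ?src z + ?snk z)"
    by (rule mean_on_mono[OF E]) auto
  also have "\<dots> = ?E ?src + ?E ?snk"
    by (rule mean_on_add[OF E])
  also have "?E ?src \<le> exp (- (s + s / 2) * l) * (tilt q n s * tilt q n (s / 2))"
    using s q by (intro source_path_upper_tail) auto
  also have "?E ?snk = ?E' ?snk"
    using q by (subst field_mean_sources_irrelevant) auto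
  also have "?E' ?snk \<le> ?E' (\<lambda>z. ?cor z + ?src z)"
  proof (rule mean_on_mono[OF E'], clarify)
    fix us vs :: "bool list" and rs :: "bool list list"
    assume "n = length us" "length vs = length us" "set rs \<subseteq> lists_of UNIV (length us)" "length rs = length us"
    then show "of_bool (real (lpp (zeros (length us)) vs rs) < l)
        \<le> (of_bool (real (lpp us vs rs) < l) + of_bool (l \<le> real (lpp us (zeros (length us)) rs)) :: real)"
      using lpp_eq_max[of rs us vs] by (auto simp: max_def split: if_splits)
  qed
  also have "\<dots> = ?E' ?cor + ?E' ?src"
    by (rule mean_on_add[OF E'])
  also have "?E' ?cor \<le> exp (- (s / 2 + - s) * l) * (tilt q n (s / 2) * tilt q n (- s))"
    using s by (intro corner_lower_tail) auto
  also have "?E' ?src \<le> exp (- (s / 2 + s / 2) * l) * (tilt q n (s / 2) * tilt q n (s / 2))"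
    using s q by (intro source_path_upper_tail) auto
  finally show ?thesis
    unfolding exit_bound_def by simp
qed

end

text \<open>Doob's inequality for the exponential of the difference walk, a submartingale because
  its one-step moment \<phi> is at least 1. The proof conditions on the first step.\<close>

lemma walk_maximal_inequality:
  fixes \<rho> a \<eta> :: real
  assumes \<rho>: "0 \<le> \<rho>" "\<rho> \<le> 1" and a: "0 \<le> a" "a \<le> 1"
  defines "\<phi> \<equiv> (1 - \<rho> + \<rho> * exp \<eta>) * (1 - a + a * exp (- \<eta>))"
  assumes \<phi>: "1 \<le> \<phi>" and \<eta>: "0 \<le> \<eta>"
  shows "bits \<rho> n (\<lambda>ws. bits a n (\<lambda>us. of_bool (\<exists>k\<le>j. m \<le> real (ones (take k ws)) - real (ones (take k us)))))
    \<le> exp (- \<eta> * m) * \<phi> ^ j"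
proof (induction n arbitrary: j m)
  case 0
  show ?case
  proof (cases "m \<le> 0")
    case True
    then have "exp 0 * 1 \<le> exp (- \<eta> * m) * \<phi> ^ j"
      using \<eta> \<phi> by (intro mult_mono one_le_power) (auto simp: mult_nonneg_nonpos)
    then show ?thesis by auto
  next
    case False
    then show ?thesis using \<phi> by (simp add: field_simps)
  qed
next
  case (Suc n)
  note R = mean_on_bits[OF \<rho>] and A = mean_on_bits[OF a]
  let ?e = "\<lambda>j m ws us. of_bool (\<exists>k\<le>j. m \<le> real (ones (take k ws)) - real (ones (take k us))) :: real"
  \<comment> \<open>At a level \<open>m \<le> 0\<close> the starting point already succeeds and the
    bound is at least 1. At a positive level index 0 fails, so the first step can be split off and
    absorbed into the level.\<close>
  consider "m \<le> 0" | "m > 0" "j = 0" | j' where "m > 0" "j = Suc j'"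
    by (cases j) (auto simp: not_le[symmetric])
  then show ?case
  proof cases
    case 1
    have "bits \<rho> (Suc n) (\<lambda>ws. bits a (Suc n) (\<lambda>us. ?e j m ws us))
      \<le> bits \<rho> (Suc n) (\<lambda>ws. bits a (Suc n) (\<lambda>us. 1))"
      by (intro mean_on_mono[OF R] mean_on_mono[OF A]) auto
    also have "\<dots> = exp 0 * 1"
      by (simp only: mean_on_const[OF R] mean_on_const[OF A]) simp
    also have "\<dots> \<le> exp (- \<eta> * m) * \<phi> ^ j"
      using \<eta> \<phi> 1 by (intro mult_mono one_le_power) (auto simp: mult_nonneg_nonpos)
    finally show ?thesis .
  next
    case 2
    then have "bits \<rho> (Suc n) (\<lambda>ws. bits a (Suc n) (\<lambda>us. ?e j m ws us)) = 0"
      by (simp only: mean_on_const[OF R] mean_on_const[OF A] le_zero_eq) (simp add: mean_on_const[OF R] mean_on_const[OF A] del: iid.simps)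
    then show ?thesis using \<phi> by simp
  next
    case 3
    have step: "?e j m (w # ws) (u # us) = ?e j' (m - of_bool w + of_bool u) ws us" for w u ws us
    proof -
      have "(\<exists>k\<le>j. m \<le> real (ones (take k (w # ws))) - real (ones (take k (u # us))))
        \<longleftrightarrow> (\<exists>k\<le>j'. m \<le> real (ones (take (Suc k) (w # ws))) - real (ones (take (Suc k) (u # us))))"
        (is "?l \<longleftrightarrow> ?r")
      proof
        assume ?l
        then obtain k where k: "k \<le> j" "m \<le> real (ones (take k (w # ws))) - real (ones (take k (u # us)))"
          by blast
        then show ?r using 3 by (cases k) (auto simp del: take_Suc_Cons)
      next
        assume ?r
        then show ?l using 3 by (metis Suc_le_mono)
      qed
      also have "\<dots> \<longleftrightarrow> (\<exists>k\<le>j'. m - of_bool w + of_bool u \<le> real (ones (take k ws)) - real (ones (take k us)))"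
        by (cases w; cases u) (simp_all add: algebra_simps)
      finally show ?thesis by simp
    qed
    have "bits \<rho> (Suc n) (\<lambda>ws. bits a (Suc n) (\<lambda>us. ?e j m ws us))
      = bern \<rho> (\<lambda>w. bits \<rho> n (\<lambda>ws. bern a (\<lambda>u. bits a n (\<lambda>us. ?e j' (m - of_bool w + of_bool u) ws us))))"
      unfolding iid.simps step ..
    also have "\<dots> = bern \<rho> (\<lambda>w. bern a (\<lambda>u. bits \<rho> n (\<lambda>ws. bits a n (\<lambda>us. ?e j' (m - of_bool w + of_bool u) ws us))))"
      by (subst mean_on_swap[OF R mean_on_bern[OF a]]) simp
    also have "\<dots> \<le> bern \<rho> (\<lambda>w. bern a (\<lambda>u. exp (- \<eta> * (m - of_bool w + of_bool u)) * \<phi> ^ j'))"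
      by (intro mean_on_mono[OF mean_on_bern[OF \<rho>]] mean_on_mono[OF mean_on_bern[OF a]] Suc)
    also have "\<dots> = exp (- \<eta> * m) * \<phi> ^ j' * \<phi>"
    proof -
      define X where "X = exp (- \<eta> * m) * \<phi> ^ j'"
      have "exp (- \<eta> * (m - of_bool w + of_bool u)) * \<phi> ^ j'
          = X * (exp (\<eta> * of_bool w) * exp (- \<eta> * of_bool u))" for w u
        by (simp add: X_def algebra_simps flip: exp_add)
      then show ?thesis
        unfolding X_def[symmetric] by (simp add: bern_def \<phi>_def algebra_simps)
    qed
    finally show ?thesis using 3 by (simp add: mult_ac)
  qed
qed

text \<open>Unless the source path wins, the boundary-free increments have larger partial sums than
  the bottom row of the stationary model. By Burke's property that row consists of independent bits,
  also independent of \<open>ws\<close>, so a walk with independent steps remains.\<close>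

lemma discrete_bound:
  fixes \<rho> q s \<eta> m :: real
  assumes q: "0 < q" "q \<le> 1" and s: "0 \<le> s" and \<rho>: "0 \<le> \<rho>" "\<rho> \<le> 1"
  defines "a \<equiv> of_odds (q * exp (- s))"
  defines "\<phi> \<equiv> (1 - \<rho> + \<rho> * exp \<eta>) * (1 - a + a * exp (- \<eta>))"
  assumes \<phi>: "1 \<le> \<phi>" and \<eta>: "0 \<le> \<eta>"
  shows "bitrows (q\<^sup>2) n n (\<lambda>rs. bits \<rho> n (\<lambda>ws. of_bool (\<exists>k\<le>j. m \<le> real (ones (take k ws))
          - real (ones (take k (top_row (zeros n) (zeros n) rs))))))
    \<le> exit_bound q n s l + exp (- \<eta> * m) * \<phi> ^ j"
proof -
  let ?E = "field_mean (q\<^sup>2) n (q * exp (- s)) (q * exp s)"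
  let ?w = "\<lambda>t. bits \<rho> n (\<lambda>ws. of_bool (\<exists>k\<le>j. m \<le> real (ones (take k ws)) - real (ones (take k t))))"
  let ?ex = "\<lambda>(us, vs, rs). of_bool (lpp (zeros n) vs rs < lpp us (zeros n) rs) :: real"
  have p: "0 \<le> q\<^sup>2" "q\<^sup>2 \<le> 1" using q by (auto simp: power_le_one)
  have odds: "0 \<le> of_odds (q * exp x)" "of_odds (q * exp x) \<le> 1" for x
    using q by (auto intro: of_odds_bounds)
  note E = mean_on_field_mean_exp[OF q, of n "- s" s] and R = mean_on_bits[OF \<rho>, of n]
  \<comment> \<open>Auxiliary boundary bits are introduced; the integrand ignores them and their
    total weight is 1.\<close>
  have "bitrows (q\<^sup>2) n n (\<lambda>rs. ?w (top_row (zeros n) (zeros n) rs))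
      = ?E (\<lambda>(us, vs, rs). ?w (top_row (zeros n) (zeros n) rs))"
    unfolding field_mean_def
    by (simp add: mean_on_const[OF mean_on_bits[OF odds]])
  also have "\<dots> \<le> ?E (\<lambda>z. ?ex z + (case z of (us, vs, rs) \<Rightarrow> ?w (top_row us vs rs)))"
  proof (rule mean_on_mono[OF E], clarify)
    fix us vs :: "bool list" and rs :: "bool list list"
    assume n: "n = length us" "length vs = length us" "set rs \<subseteq> lists_of UNIV (length us)"
      "length rs = length us"
    let ?z = "zeros (length us)"
    let ?w' = "\<lambda>t. bits \<rho> (length us) (\<lambda>ws. of_bool (\<exists>k\<le>j. m \<le> real (ones (take k ws)) - real (ones (take k t))))"
    have R': "mean_on (lists_of UNIV (length us)) (bits \<rho> (length us))" using R n by simp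
    show "?w' (top_row ?z ?z rs) \<le> of_bool (lpp ?z vs rs < lpp us ?z rs) + ?w' (top_row us vs rs)"
    proof (cases "lpp us ?z rs \<le> lpp ?z vs rs")
      case True
      have "ones (take k (top_row us vs rs)) \<le> ones (take k (top_row ?z ?z rs))" for k
        using n True by (intro ones_take_top_row_le) auto
      then have le: "real (ones (take k (top_row us vs rs))) \<le> real (ones (take k (top_row ?z ?z rs)))" for k
        by simp
      have "?w' (top_row ?z ?z rs) \<le> ?w' (top_row us vs rs)"
      proof (rule mean_on_mono[OF R'])
        fix ws :: "bool list"
        have "\<exists>k\<le>j. m \<le> real (ones (take k ws)) - real (ones (take k (top_row us vs rs)))"
          if "\<exists>k\<le>j. m \<le> real (ones (take k ws)) - real (ones (take k (top_row ?z ?z rs)))"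
          using that le by (meson diff_left_mono order_trans)
        then show "of_bool (\<exists>k\<le>j. m \<le> real (ones (take k ws)) - real (ones (take k (top_row ?z ?z rs))))
          \<le> (of_bool (\<exists>k\<le>j. m \<le> real (ones (take k ws)) - real (ones (take k (top_row us vs rs)))) :: real)"
          by simp
      qed
      then show ?thesis using True by simp
    next
      case False
      have "?w' (top_row ?z ?z rs) \<le> bits \<rho> (length us) (\<lambda>ws. 1)"
        by (rule mean_on_mono[OF R']) auto
      moreover have "bits \<rho> (length us) (\<lambda>ws. 0) \<le> ?w' (top_row us vs rs)"
        by (rule mean_on_mono[OF R']) auto
      ultimately show ?thesis
        using False by (simp add: mean_on_const[OF R'])
    qed
  qed
  also have "\<dots> = ?E ?ex + ?E (\<lambda>(us, vs, rs). ?w (top_row us vs rs))"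
    by (rule mean_on_add[OF E])
  also have "?E ?ex \<le> exit_bound q n s l"
    by (rule exit_probability[OF q s])
  also have "?E (\<lambda>(us, vs, rs). ?w (top_row us vs rs)) = bits a n ?w"
  proof -
    have "(1 - of_odds (q * exp (- s))) * (1 - of_odds (q * exp s)) * q\<^sup>2
        = of_odds (q * exp (- s)) * of_odds (q * exp s)"
      using q by (simp add: one_minus_of_odds) (simp add: of_odds_def power2_eq_square exp_minus)
    from top_row_burke[OF this odds odds p, of n n ?w] show ?thesis
      by (simp add: field_mean_def a_def)
  qed
  also have "\<dots> = bits \<rho> n (\<lambda>ws. bits a n (\<lambda>us.
      of_bool (\<exists>k\<le>j. m \<le> real (ones (take k ws)) - real (ones (take k us)))))"
    unfolding a_def by (rule mean_on_swap[OF mean_on_bits[OF odds] R])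
  also have "\<dots> \<le> exp (- \<eta> * m) * \<phi> ^ j"
    using \<phi> \<eta> \<rho> odds unfolding \<phi>_def a_def by (intro walk_maximal_inequality) auto
  finally show ?thesis by simp
qed

section \<open>Chains of cells\<close>

definition cell_chain :: "nat \<Rightarrow> bool list list \<Rightarrow> (nat \<times> nat) list \<Rightarrow> bool" where
  "cell_chain n rs cs \<longleftrightarrow> sorted_wrt (\<lambda>c d. fst c < fst d \<and> snd c < snd d) cs \<and>
     (\<forall>(i, j)\<in>set cs. i < n \<and> j < length rs \<and> rs ! j ! i)"

text \<open>The length of a longest strictly increasing chain of occupied cells, as
  \<open>cell_chain_length_le\<close> and \<open>cell_chain_exists\<close> show together.\<close>

definition hlen :: "nat \<Rightarrow> bool list list \<Rightarrow> nat" where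
  "hlen n rs = lpp (zeros n) (zeros (length rs)) rs"

lemma hlen_eq_ones: "hlen n rs = ones (top_row (zeros n) (zeros (length rs)) rs)"
  by (simp add: hlen_def lpp_def ones_zeros)

lemma hlen_0: "rs \<in> lists_of (lists_of UNIV 0) m \<Longrightarrow> hlen 0 rs = 0"
  by (simp add: hlen_def lpp_Nil ones_zeros)

lemma hlen_Nil: "hlen n [] = 0"
  by (simp add: hlen_def lpp_def ones_zeros)

lemma hlen_rec:
  assumes "rs \<in> lists_of (lists_of UNIV (Suc n)) (Suc m)"
  shows "hlen (Suc n) rs = max (hlen n (map tl rs))
    (max (hlen (Suc n) (tl rs)) (hlen n (map tl (tl rs)) + of_bool (rs ! 0 ! 0)))"
proof -
  obtain a as rs' where rs: "rs = (a # as) # rs'" "length as = n" "length rs' = m"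
      "rs' \<in> lists_of (lists_of UNIV (Suc (length (zeros n)))) m"
    using assms by (cases rs; cases "hd rs") auto
  show ?thesis
    using lpp_Cons[of as "zeros n" rs' m False False "zeros m" a] rs
    by (simp add: hlen_def)
qed

lemma map_tl_nth:
  assumes "rs \<in> lists_of (lists_of UNIV (Suc n)) m" "j < m" "i < n"
  shows "map tl rs ! j ! i = rs ! j ! Suc i"
proof -
  have "length (rs ! j) = Suc n" using assms by (auto simp: subset_iff)
  then show ?thesis using assms by (simp add: nth_tl)
qed

lemma lists_of_tl_row:
  "rs \<in> lists_of A (Suc m) \<Longrightarrow> tl rs \<in> lists_of A m"
  by (cases rs) auto

text \<open>A chain not starting at cell (0, 0) avoids the first column or the first row and shifts
  into a smaller field; otherwise its tail avoids both. These are the terms of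
  \<open>hlen_rec\<close>.\<close>

lemma cell_chain_length_le:
  "rs \<in> lists_of (lists_of UNIV n) m \<Longrightarrow> cell_chain n rs cs \<Longrightarrow> length cs \<le> hlen n rs"
proof (induction m arbitrary: n rs cs)
  case 0
  then have "cs = []" by (cases cs) (auto simp: cell_chain_def)
  then show ?case by simp
next
  case (Suc m)
  note IHm = Suc.IH
  from Suc.prems show ?case
  proof (induction n arbitrary: rs cs)
    case 0
    then have "cs = []" by (cases cs) (auto simp: cell_chain_def)
    then show ?case by simp
  next
    case (Suc n)
    note rs = Suc.prems(1)
    note rec = hlen_rec[OF rs]
    have tl1: "map tl rs \<in> lists_of (lists_of UNIV n) (Suc m)" by (rule lists_of_tl[OF rs])
    have tl2: "tl rs \<in> lists_of (lists_of UNIV (Suc n)) m" by (rule lists_of_tl_row[OF rs])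
    have tl3: "map tl (tl rs) \<in> lists_of (lists_of UNIV n) m" by (rule lists_of_tl[OF tl2])
    have len: "length rs = Suc m" using rs by simp
    show ?case
    proof (cases cs)
      case Nil
      then show ?thesis by simp
    next
      case (Cons c cs')
      obtain i j where c: "c = (i, j)" by (cases c)
      have cells: "i' < Suc n" "j' < Suc m" "rs ! j' ! i'" if "(i', j') \<in> set cs" for i' j'
        using Suc.prems(2) that len by (auto simp: cell_chain_def)
      have after: "i < i'" "j < j'" if "(i', j') \<in> set cs'" for i' j'
        using Suc.prems(2) that Cons c by (auto simp: cell_chain_def)
      have srt: "sorted_wrt (\<lambda>c d. fst c < fst d \<and> snd c < snd d) cs"
        using Suc.prems(2) by (simp add: cell_chain_def)
      consider "i > 0" | "j > 0" | "i = 0" "j = 0" by auto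
      then show ?thesis
      proof cases
        case 1
        have pos: "0 < i'" if "(i', j') \<in> set cs" for i' j'
          using that after 1 Cons c by fastforce
        have "cell_chain n (map tl rs) (map (\<lambda>(i, j). (i - 1, j)) cs)"
          unfolding cell_chain_def
        proof (intro conjI)
          show "sorted_wrt (\<lambda>c d. fst c < fst d \<and> snd c < snd d) (map (\<lambda>(i, j). (i - 1, j)) cs)"
            unfolding sorted_wrt_map
            by (rule sorted_wrt_mono_rel[OF _ srt]) (use pos in \<open>auto simp: diff_less_mono Suc_le_eq\<close>)
          show "\<forall>(i, j)\<in>set (map (\<lambda>(i, j). (i - 1, j)) cs). i < n \<and> j < length (map tl rs) \<and> map tl rs ! j ! i"
          proof (clarsimp)
            fix i' j' assume ij: "(i', j') \<in> set cs"
            show "i' - Suc 0 < n \<and> j' < length rs \<and> map tl rs ! j' ! (i' - Suc 0)"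
              using map_tl_nth[OF rs, of j' "i' - 1"] cells[OF ij] pos[OF ij] len by auto
          qed
        qed
        from Suc.IH[OF tl1 this] show ?thesis unfolding rec by simp
      next
        case 2
        have pos: "0 < j'" if "(i', j') \<in> set cs" for i' j'
          using that after 2 Cons c by fastforce
        have "cell_chain (Suc n) (tl rs) (map (\<lambda>(i, j). (i, j - 1)) cs)"
          unfolding cell_chain_def
        proof (intro conjI)
          show "sorted_wrt (\<lambda>c d. fst c < fst d \<and> snd c < snd d) (map (\<lambda>(i, j). (i, j - 1)) cs)"
            unfolding sorted_wrt_map
            by (rule sorted_wrt_mono_rel[OF _ srt]) (use pos in \<open>auto simp: diff_less_mono Suc_le_eq\<close>)
          show "\<forall>(i, j)\<in>set (map (\<lambda>(i, j). (i, j - 1)) cs). i < Suc n \<and> j < length (tl rs) \<and> tl rs ! j ! i"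
          proof (clarsimp)
            fix i' j' assume ij: "(i', j') \<in> set cs"
            show "i' < Suc n \<and> j' - Suc 0 < length rs - Suc 0 \<and> tl rs ! (j' - Suc 0) ! i'"
              using nth_tl[of "j' - 1" rs] cells[OF ij] pos[OF ij] len by auto
          qed
        qed
        from IHm[OF tl2 this] show ?thesis unfolding rec by simp
      next
        case 3
        have srt': "sorted_wrt (\<lambda>c d. fst c < fst d \<and> snd c < snd d) cs'"
          using srt Cons by simp
        have cells': "i' < Suc n" "j' < Suc m" "rs ! j' ! i'" "0 < i'" "0 < j'"
          if "(i', j') \<in> set cs'" for i' j'
          using cells[of i' j'] after[of i' j'] that Cons 3 by auto
        have "cell_chain n (map tl (tl rs)) (map (\<lambda>(i, j). (i - 1, j - 1)) cs')"
          unfolding cell_chain_def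
        proof (intro conjI)
          show "sorted_wrt (\<lambda>c d. fst c < fst d \<and> snd c < snd d) (map (\<lambda>(i, j). (i - 1, j - 1)) cs')"
            unfolding sorted_wrt_map
            by (rule sorted_wrt_mono_rel[OF _ srt']) (use cells' in \<open>auto simp: diff_less_mono Suc_le_eq\<close>)
          show "\<forall>(i, j)\<in>set (map (\<lambda>(i, j). (i - 1, j - 1)) cs').
              i < n \<and> j < length (map tl (tl rs)) \<and> map tl (tl rs) ! j ! i"
          proof (clarsimp)
            fix i' j' assume ij: "(i', j') \<in> set cs'"
            have "map tl (tl rs) ! (j' - 1) ! (i' - 1) = tl rs ! (j' - 1) ! i'"
              using map_tl_nth[OF tl2, of "j' - 1" "i' - 1"] cells'[OF ij] by auto
            also have "\<dots> = rs ! j' ! i'"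
              using nth_tl[of "j' - 1" rs] cells'[OF ij] len by auto
            finally show "i' - Suc 0 < n \<and> j' - Suc 0 < length rs - Suc 0 \<and> map tl (tl rs) ! (j' - Suc 0) ! (i' - Suc 0)"
              using cells'[OF ij] len by auto
          qed
        qed
        from IHm[OF tl3 this] have "length cs' \<le> hlen n (map tl (tl rs))" by simp
        moreover have "rs ! 0 ! 0" using cells[of 0 0] Cons c 3 by simp
        ultimately show ?thesis unfolding rec by (simp add: Cons)
      qed
    qed
  qed
qed

text \<open>An optimal chain for the largest term of \<open>hlen_rec\<close> is shifted back into
  the full field, with the corner cell put in front when it is occupied and counted.\<close>

lemma cell_chain_exists:
  "rs \<in> lists_of (lists_of UNIV n) m \<Longrightarrow> \<exists>cs. cell_chain n rs cs \<and> length cs = hlen n rs"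
proof (induction m arbitrary: n rs)
  case 0
  then show ?case by (intro exI[of _ "[]"]) (auto simp: cell_chain_def hlen_Nil)
next
  case (Suc m)
  note IHm = Suc.IH
  from Suc.prems show ?case
  proof (induction n arbitrary: rs)
    case 0
    then show ?case by (intro exI[of _ "[]"]) (auto simp: cell_chain_def hlen_0[OF 0])
  next
    case (Suc n)
    note rs = Suc.prems(1)
    note rec = hlen_rec[OF rs]
    have tl1: "map tl rs \<in> lists_of (lists_of UNIV n) (Suc m)" by (rule lists_of_tl[OF rs])
    have tl2: "tl rs \<in> lists_of (lists_of UNIV (Suc n)) m" by (rule lists_of_tl_row[OF rs])
    have tl3: "map tl (tl rs) \<in> lists_of (lists_of UNIV n) m" by (rule lists_of_tl[OF tl2])
    have len: "length rs = Suc m" using rs by simp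
    obtain c1 where c1: "cell_chain n (map tl rs) c1" "length c1 = hlen n (map tl rs)"
      using Suc.IH[OF tl1] by auto
    obtain c2 where c2: "cell_chain (Suc n) (tl rs) c2" "length c2 = hlen (Suc n) (tl rs)"
      using IHm[OF tl2] by auto
    obtain c3 where c3: "cell_chain n (map tl (tl rs)) c3" "length c3 = hlen n (map tl (tl rs))"
      using IHm[OF tl3] by auto
    have d1: "cell_chain (Suc n) rs (map (\<lambda>(i, j). (Suc i, j)) c1)"
      using c1(1) map_tl_nth[OF rs] len
      by (fastforce simp: cell_chain_def sorted_wrt_map case_prod_beta)
    have d2: "cell_chain (Suc n) rs (map (\<lambda>(i, j). (i, Suc j)) c2)"
      using c2(1) len
      by (fastforce simp: cell_chain_def sorted_wrt_map case_prod_beta nth_tl)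
    have d3: "cell_chain (Suc n) rs (map (\<lambda>(i, j). (Suc i, Suc j)) c3)"
      using c3(1) map_tl_nth[OF tl2] len
      by (fastforce simp: cell_chain_def sorted_wrt_map case_prod_beta nth_tl)
    have d4: "cell_chain (Suc n) rs ((0, 0) # map (\<lambda>(i, j). (Suc i, Suc j)) c3)" if "rs ! 0 ! 0"
      using d3 that len by (auto simp: cell_chain_def)
    have "hlen (Suc n) rs \<in> {length c1, length c2, length c3 + of_bool (rs ! 0 ! 0)}"
      unfolding rec c1(2) c2(2) c3(2) by (auto simp: max_def)
    then consider "hlen (Suc n) rs = length c1" | "hlen (Suc n) rs = length c2"
      | "hlen (Suc n) rs = length c3" | "hlen (Suc n) rs = Suc (length c3)" "rs ! 0 ! 0"
      by (cases "rs ! 0 ! 0") auto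
    then show ?case
    proof cases
      case 1 then show ?thesis using d1 by (metis length_map)
    next
      case 2 then show ?thesis using d2 by (metis length_map)
    next
      case 3 then show ?thesis using d3 by (metis length_map)
    next
      case 4 then show ?thesis using d4 by (metis length_map length_Cons)
    qed
  qed
qed

section \<open>Discretisation of a point configuration\<close>

definition strip :: "real \<Rightarrow> nat \<Rightarrow> real set" where
  "strip h i = {real i * h<..real (Suc i) * h}"

text \<open>Strips are closed on the right, hence the ceiling minus one in place of a floor.\<close>

definition idx :: "real \<Rightarrow> real \<Rightarrow> nat" where
  "idx h x = nat (\<lceil>x / h\<rceil> - 1)"

text \<open>Occupation is tested by \<open>card\<close> because the law of the process is given
  through counts. An infinite cell would read as empty; thinness excludes this.\<close>

definition cell_field :: "real \<Rightarrow> nat \<Rightarrow> (real \<times> real) set \<Rightarrow> bool list list" where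
  "cell_field h K A =
     map (\<lambda>j. map (\<lambda>i. card (A \<inter> (strip h i \<times> strip h j)) \<noteq> 0) [0..<K]) [0..<K]"

definition cell_sources :: "real \<Rightarrow> nat \<Rightarrow> real set \<Rightarrow> bool list" where
  "cell_sources h K S = map (\<lambda>i. card (S \<inter> strip h i) \<noteq> 0) [0..<K]"

definition thin :: "'a set \<Rightarrow> bool" where
  "thin X \<longleftrightarrow> finite X \<and> card X \<le> 1"

lemma thin_eq: "thin X \<Longrightarrow> x \<in> X \<Longrightarrow> y \<in> X \<Longrightarrow> x = y"
  unfolding thin_def by (metis One_nat_def card_le_Suc0_iff_eq)

lemma thin_subset: "thin X \<Longrightarrow> Y \<subseteq> X \<Longrightarrow> thin Y"
  unfolding thin_def by (meson card_mono finite_subset le_trans)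

lemma cell_field_lists_of: "cell_field h K A \<in> lists_of (lists_of UNIV K) K"
  by (auto simp: cell_field_def)

lemma cell_field_nth:
  "i < K \<Longrightarrow> j < K \<Longrightarrow> cell_field h K A ! j ! i \<longleftrightarrow> card (A \<inter> (strip h i \<times> strip h j)) \<noteq> 0"
  by (simp add: cell_field_def)

lemma idx_less_iff:
  assumes "h > 0" "x > 0"
  shows "idx h x < k \<longleftrightarrow> x \<le> real k * h"
proof -
  have "\<lceil>x / h\<rceil> \<ge> 1" using assms by (simp add: Suc_le_eq one_le_ceiling)
  then have "idx h x < k \<longleftrightarrow> \<lceil>x / h\<rceil> \<le> int k"
    unfolding idx_def by linarith
  also have "\<dots> \<longleftrightarrow> x / h \<le> real k" by (simp add: ceiling_le_iff)
  finally show ?thesis using assms by (simp add: field_simps)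
qed

lemma strip_idx:
  assumes "h > 0" "x > 0"
  shows "x \<in> strip h (idx h x)"
  using idx_less_iff[OF assms, of "idx h x"] idx_less_iff[OF assms, of "Suc (idx h x)"]
  by (auto simp: strip_def)

lemma idx_mono: "h > 0 \<Longrightarrow> 0 < x \<Longrightarrow> x \<le> y \<Longrightarrow> idx h x \<le> idx h y"
  unfolding idx_def by (intro nat_mono diff_right_mono ceiling_mono divide_right_mono) auto

lemma strip_less:
  assumes "h > 0" "i < j" "x \<in> strip h i" "y \<in> strip h j"
  shows "x < y"
proof -
  have "x \<le> real (Suc i) * h" using assms by (simp add: strip_def)
  also have "\<dots> \<le> real j * h" using assms by (intro mult_right_mono) auto
  also have "\<dots> < y" using assms by (simp add: strip_def)
  finally show ?thesis .
qed

lemma strip_pos: "h > 0 \<Longrightarrow> x \<in> strip h i \<Longrightarrow> 0 < x"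
proof -
  assume h: "h > 0" "x \<in> strip h i"
  have "0 \<le> real i * h" using h by simp
  also have "\<dots> < x" using h by (simp add: strip_def)
  finally show "0 < x" .
qed

lemma ones_eq_sum: "ones xs = (\<Sum>i<length xs. of_bool (xs ! i))"
  by (induction xs) (auto simp: sum.lessThan_Suc_shift simp del: sum.lessThan_Suc)

section \<open>Chains of points against chains of cells\<close>

context
  fixes h t :: real and K :: nat and A :: "(real \<times> real) set" and S :: "real set"
  assumes K: "K > 0" and t: "t > 0" and h: "h = t / real K"
    and cols: "\<And>i. i < K \<Longrightarrow> thin (A \<inter> (strip h i \<times> {0<..t}))"
    and rows: "\<And>j. j < K \<Longrightarrow> thin (A \<inter> ({0<..t} \<times> strip h j))"
    and src: "\<And>i. i < K \<Longrightarrow> thin (S \<inter> strip h i)"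
begin

private abbreviation "rs \<equiv> cell_field h K A"
private abbreviation "ws \<equiv> cell_sources h K S"
private abbreviation "T \<equiv> top_row (zeros K) (zeros K) rs"

private lemma h_pos: "h > 0" using K t h by simp

private lemma Kh: "real K * h = t" using K h by simp

private lemma idx_less_K: "0 < x \<Longrightarrow> x \<le> t \<Longrightarrow> idx h x < K"
  using idx_less_iff[OF h_pos] Kh by simp

private lemma strip_le_t: "i < K \<Longrightarrow> x \<in> strip h i \<Longrightarrow> x \<le> t"
proof -
  assume "i < K" "x \<in> strip h i"
  then have "x \<le> real (Suc i) * h" by (simp add: strip_def)
  also have "\<dots> \<le> real K * h" using \<open>i < K\<close> h_pos by (intro mult_right_mono) auto
  finally show "x \<le> t" by (simp add: Kh)
qed

text \<open>Thin columns and rows force distinct points of a chain into distinct columns and rows,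
  so their cells form a strictly increasing chain. As the points lie to the right of
  \<open>real k * h\<close>, the first \<open>k\<close> columns are avoided.\<close>

lemma chain_length_le:
  assumes xs: "set xs \<subseteq> A \<inter> ({z<..t} \<times> {0<..t})" "ne_chain xs"
    and z: "real k * h \<le> z"
  shows "length xs \<le> ones (drop k T)"
proof -
  let ?c = "\<lambda>p. (idx h (fst p) - k, idx h (snd p))"
  have z0: "0 \<le> z" using z h_pos by (meson mult_nonneg_nonneg of_nat_0_le_iff less_imp_le order_trans)
  have pt: "fst p > 0" "fst p \<le> t" "snd p > 0" "snd p \<le> t" "p \<in> A" "k \<le> idx h (fst p)"
    if "p \<in> set xs" for p
  proof -
    have p: "p \<in> A" "fst p > z" "fst p \<le> t" "snd p > 0" "snd p \<le> t" using xs(1) that by auto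
    show pos: "fst p > 0" using p z0 by simp
    show "k \<le> idx h (fst p)"
      using idx_less_iff[OF h_pos pos, of k] p z by linarith
  qed (use xs(1) that in auto)
  have less: "fst (?c p) < fst (?c p') \<and> snd (?c p) < snd (?c p')"
    if "p \<in> set xs" "p' \<in> set xs" "fst p < fst p' \<and> snd p < snd p'" for p p'
  proof -
    have ij: "idx h (fst p) < K" "idx h (snd p) < K"
      using idx_less_K pt[OF that(1)] by auto
    have "idx h (fst p) \<noteq> idx h (fst p')"
    proof
      assume eq: "idx h (fst p) = idx h (fst p')"
      have "p \<in> A \<inter> (strip h (idx h (fst p)) \<times> {0<..t})" "p' \<in> A \<inter> (strip h (idx h (fst p)) \<times> {0<..t})"
        using strip_idx[OF h_pos, of "fst p"] strip_idx[OF h_pos, of "fst p'"] pt[OF that(1)] pt[OF that(2)]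
        by (auto simp: eq mem_Times_iff)
      from thin_eq[OF cols[OF ij(1)] this] that(3) show False by simp
    qed
    moreover have "idx h (snd p) \<noteq> idx h (snd p')"
    proof
      assume eq: "idx h (snd p) = idx h (snd p')"
      have "p \<in> A \<inter> ({0<..t} \<times> strip h (idx h (snd p)))" "p' \<in> A \<inter> ({0<..t} \<times> strip h (idx h (snd p)))"
        using strip_idx[OF h_pos, of "snd p"] strip_idx[OF h_pos, of "snd p'"] pt[OF that(1)] pt[OF that(2)]
        by (auto simp: eq mem_Times_iff)
      from thin_eq[OF rows[OF ij(2)] this] that(3) show False by simp
    qed
    moreover have "idx h (fst p) \<le> idx h (fst p')" "idx h (snd p) \<le> idx h (snd p')"
      using idx_mono[OF h_pos] pt[OF that(1)] that(3) by auto
    ultimately show ?thesis using pt[OF that(1)] by auto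
  qed
  have "cell_chain (K - k) (map (drop k) rs) (map ?c xs)"
    unfolding cell_chain_def
  proof (intro conjI)
    show "sorted_wrt (\<lambda>c d. fst c < fst d \<and> snd c < snd d) (map ?c xs)"
      unfolding sorted_wrt_map using xs(2)[unfolded ne_chain_def]
      by (rule sorted_wrt_mono_rel[rotated]) (rule less)
    show "\<forall>(i, j)\<in>set (map ?c xs). i < K - k \<and> j < length (map (drop k) rs) \<and> map (drop k) rs ! j ! i"
    proof clarify
      fix i j assume "(i, j) \<in> set (map ?c xs)"
      then obtain p where p: "p \<in> set xs" and ij: "i = idx h (fst p) - k" "j = idx h (snd p)"
        by auto
      note q = pt[OF p]
      have lt: "idx h (fst p) < K" "j < K"
        using idx_less_K[of "fst p"] idx_less_K[of "snd p"] q ij by auto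
      have mem: "p \<in> A \<inter> (strip h (idx h (fst p)) \<times> strip h j)"
        using q strip_idx[OF h_pos, of "fst p"] strip_idx[OF h_pos, of "snd p"] ij
        by (auto simp: mem_Times_iff)
      have "strip h j \<subseteq> {0<..t}"
        using strip_le_t[OF lt(2)] strip_pos[OF h_pos] by auto
      then have "thin (A \<inter> (strip h (idx h (fst p)) \<times> strip h j))"
        by (intro thin_subset[OF cols[OF lt(1)]]) auto
      then have "card (A \<inter> (strip h (idx h (fst p)) \<times> strip h j)) \<noteq> 0"
        using mem by (auto simp: thin_def card_eq_0_iff)
      then have "rs ! j ! (k + i)"
        using cell_field_nth[OF lt] q ij by simp
      moreover have "length (rs ! j) = K"
        using cell_field_lists_of[of h K A] lt(2) by (auto simp: subset_iff)
      ultimately show "i < K - k \<and> j < length (map (drop k) rs) \<and> map (drop k) rs ! j ! i"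
        using lt q ij cell_field_lists_of[of h K A] by auto
    qed
  qed
  moreover have "map (drop k) rs \<in> lists_of (lists_of UNIV (K - k)) K"
    using cell_field_lists_of[of h K A] by (auto simp: subset_iff)
  ultimately have "length (map ?c xs) \<le> hlen (K - k) (map (drop k) rs)"
    by (intro cell_chain_length_le)
  also have "\<dots> = ones (drop k T)"
    using cell_field_lists_of[of h K A] by (simp add: hlen_eq_ones drop_top_row)
  finally show ?thesis by simp
qed

lemma Alen_le: "real k * h \<le> z \<Longrightarrow> Alen A t z \<le> ones (drop k T)"
  unfolding Alen_def
  by (rule cSup_least) (use chain_length_le in \<open>auto simp: ne_chain_def intro!: exI[of _ "[]"]\<close>)

text \<open>One point chosen from each cell of an optimal cell chain gives a chain of points, since
  different strips are strictly ordered.\<close>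

lemma Alen_0_ge: "ones T \<le> Alen A t 0"
proof -
  have len: "length rs = K" using cell_field_lists_of[of h K A] by simp
  obtain cs where cs: "cell_chain K rs cs" "length cs = hlen K rs"
    using cell_chain_exists[OF cell_field_lists_of] by blast
  have ex: "\<exists>p. p \<in> A \<inter> (strip h (fst c) \<times> strip h (snd c))" if "c \<in> set cs" for c
  proof -
    have "fst c < K" "snd c < K" "rs ! snd c ! fst c"
      using cs(1) that len unfolding cell_chain_def by fastforce+
    then have "card (A \<inter> (strip h (fst c) \<times> strip h (snd c))) \<noteq> 0"
      using cell_field_nth by blast
    then show ?thesis by (metis card.empty ex_in_conv)
  qed
  then obtain f where f: "\<And>c. c \<in> set cs \<Longrightarrow> f c \<in> A \<inter> (strip h (fst c) \<times> strip h (snd c))"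
    by metis
  have lt: "fst c < K" "snd c < K" if "c \<in> set cs" for c
    using cs(1) that len unfolding cell_chain_def by fastforce+
  have sub: "set (map f cs) \<subseteq> A \<inter> ({0<..t} \<times> {0<..t})"
  proof
    fix p assume "p \<in> set (map f cs)"
    then obtain c where c: "c \<in> set cs" "p = f c" by auto
    then show "p \<in> A \<inter> ({0<..t} \<times> {0<..t})"
      using f[OF c(1)] lt[OF c(1)] strip_le_t strip_pos[OF h_pos] by (auto simp: mem_Times_iff)
  qed
  have "ne_chain (map f cs)"
    unfolding ne_chain_def sorted_wrt_map
  proof (rule sorted_wrt_mono_rel)
    show "sorted_wrt (\<lambda>c d. fst c < fst d \<and> snd c < snd d) cs"
      using cs(1) by (simp add: cell_chain_def)
    fix c d assume "c \<in> set cs" "d \<in> set cs" "fst c < fst d \<and> snd c < snd d"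
    then show "fst (f c) < fst (f d) \<and> snd (f c) < snd (f d)"
      using f[of c] f[of d] strip_less[OF h_pos] by (auto simp: mem_Times_iff)
  qed
  with sub cs(2) have "hlen K rs \<in> {length xs |xs. set xs \<subseteq> A \<inter> ({0<..t} \<times> {0<..t}) \<and> ne_chain xs}"
    by (metis (mono_tags, lifting) length_map mem_Collect_eq)
  then have "hlen K rs \<le> Alen A t 0"
    \<comment> \<open>A supremum of naturals is informative only for a bounded set; the bound is the
      converse comparison.\<close>
    unfolding Alen_def using chain_length_le[where k = 0 and z = 0]
    by (intro cSup_upper bdd_aboveI[of _ "ones T"]) auto
  then show ?thesis by (simp add: hlen_eq_ones len)
qed

lemma Nsrc_le:
  assumes z: "z < real (Suc k) * h" "k < K"
  shows "Nsrc S z \<le> ones (take (Suc k) ws)"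
proof -
  have sub: "S \<inter> {0<..z} \<subseteq> (\<Union>i<Suc k. S \<inter> strip h i)"
  proof
    fix x assume x: "x \<in> S \<inter> {0<..z}"
    have "idx h x < Suc k" using idx_less_iff[OF h_pos, of x "Suc k"] x z by auto
    then show "x \<in> (\<Union>i<Suc k. S \<inter> strip h i)"
      using strip_idx[OF h_pos, of x] x by auto
  qed
  have fin: "finite (S \<inter> strip h i)" "card (S \<inter> strip h i) \<le> 1" if "i < Suc k" for i
    using src[of i] that z by (auto simp: thin_def)
  have "Nsrc S z \<le> card (\<Union>i<Suc k. S \<inter> strip h i)"
    unfolding Nsrc_def using fin by (intro card_mono[OF _ sub] finite_UN_I) auto
  also have "\<dots> \<le> (\<Sum>i<Suc k. card (S \<inter> strip h i))"
    by (rule card_UN_le) simp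
  also have "\<dots> \<le> (\<Sum>i<Suc k. of_bool (take (Suc k) ws ! i))"
  proof (rule sum_mono)
    fix i assume i: "i \<in> {..<Suc k}"
    then show "card (S \<inter> strip h i) \<le> of_bool (take (Suc k) ws ! i)"
      using fin(2)[of i] z by (cases "card (S \<inter> strip h i)") (auto simp: cell_sources_def)
  qed
  also have "\<dots> = ones (take (Suc k) ws)"
    using z by (subst ones_eq_sum) (simp add: cell_sources_def)
  finally show ?thesis .
qed

text \<open>Each \<open>z\<close> is rounded down to a grid point \<open>real k * h\<close>. The
  chain length from \<open>z\<close> is bounded by the columns from \<open>k\<close> on, while the
  sources may include one more strip; this strip is the loss from \<open>m\<close> to
  \<open>m - 1\<close>.\<close>

lemma cell_event:
  assumes Z: "0 \<le> Z" "Z < t"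
    and sup: "m \<le> (SUP z\<in>{0..Z}. real (Nsrc S z + Alen A t z)) - real (Alen A t 0)"
  shows "\<exists>k\<le>nat \<lfloor>Z / h\<rfloor>. m - 1 \<le> real (ones (take k ws)) - real (ones (take k T))"
proof (rule ccontr)
  assume "\<not> ?thesis"
  then have no: "real (ones (take k ws)) - real (ones (take k T)) < m - 1" if "k \<le> nat \<lfloor>Z / h\<rfloor>" for k
    using that by force
  let ?b = "\<lambda>k. real (ones (take k ws)) + 1 + real (ones (drop k T))"
  \<comment> \<open>A maximum over finitely many grid indices, so the strict inequality survives the
    supremum over \<open>z\<close>.\<close>
  define B where "B = Max (?b ` {..nat \<lfloor>Z / h\<rfloor>})"
  have "real (Nsrc S z + Alen A t z) \<le> B" if z: "z \<in> {0..Z}" for z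
  proof -
    define k where "k = nat \<lfloor>z / h\<rfloor>"
    have zh: "0 \<le> z / h" using z h_pos by simp
    have k: "real k \<le> z / h" "z / h < real (Suc k)"
      unfolding k_def using zh by linarith+
    then have kz: "real k * h \<le> z" "z < real (Suc k) * h"
      using h_pos by (auto simp: field_simps)
    have "real k * h < real K * h" using kz z Z Kh by auto
    then have kK: "k < K" using h_pos by simp
    have "ones (take (Suc k) ws) \<le> ones (take k ws) + 1"
      using kK by (simp add: take_Suc_conv_app_nth cell_sources_def)
    then have "real (Nsrc S z + Alen A t z) \<le> ?b k"
      using Nsrc_le[OF kz(2) kK] Alen_le[OF kz(1)] by simp
    moreover have "k \<le> nat \<lfloor>Z / h\<rfloor>"
      unfolding k_def using z h_pos by (intro nat_mono floor_mono divide_right_mono) auto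
    then have "?b k \<le> B" unfolding B_def by (intro Max_ge) auto
    ultimately show ?thesis by linarith
  qed
  then have "(SUP z\<in>{0..Z}. real (Nsrc S z + Alen A t z)) \<le> B"
    using Z by (intro cSUP_least) auto
  moreover have "B < m + real (ones T)"
  proof -
    have "B \<in> ?b ` {..nat \<lfloor>Z / h\<rfloor>}" unfolding B_def by (intro Max_in) auto
    then obtain k where "k \<le> nat \<lfloor>Z / h\<rfloor>" "B = ?b k" by auto
    then show ?thesis using no[of k] ones_take_drop[of k T] by linarith
  qed
  moreover have "real (ones T) \<le> real (Alen A t 0)" using Alen_0_ge by simp
  ultimately show False using sup by linarith
qed

end

section \<open>Law of the discretised Poisson processes\<close>

context prob_space
begin

lemma poisson_finite:
  assumes "poisson_counts M X D" "fin_borel_in D B"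
  shows "{\<omega> \<in> space M. finite (X \<omega> \<inter> B)} \<in> sets M" "prob {\<omega> \<in> space M. finite (X \<omega> \<inter> B)} = 1"
proof -
  let ?C = "\<lambda>k. {\<omega> \<in> space M. finite (X \<omega> \<inter> B) \<and> card (X \<omega> \<inter> B) = k}"
  let ?l = "measure lborel B"
  have meas: "?C k \<in> sets M" and pr: "prob (?C k) = ?l ^ k / fact k * exp (- ?l)" for k
    using assms unfolding poisson_counts_def by blast+
  have U: "{\<omega> \<in> space M. finite (X \<omega> \<inter> B)} = (\<Union>k. ?C k)" by auto
  show "{\<omega> \<in> space M. finite (X \<omega> \<inter> B)} \<in> sets M" unfolding U using meas by auto
  have "(\<lambda>k. prob (?C k)) sums prob (\<Union>k. ?C k)"
    using meas by (intro finite_measure_UNION) (auto simp: disjoint_family_on_def)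
  moreover have "(\<lambda>k. prob (?C k)) sums (exp ?l * exp (- ?l))"
    unfolding pr using sums_mult2[OF exp_converges[of ?l], of "exp (- ?l)"]
    by (simp add: field_simps)
  ultimately show "prob {\<omega> \<in> space M. finite (X \<omega> \<inter> B)} = 1"
    unfolding U using sums_unique2 by (fastforce simp flip: exp_add)
qed

text \<open>The event \<open>card = 0\<close> also contains the infinite configurations, which form
  a null set because the Poisson weights sum to 1.\<close>

lemma poisson_card_eq_0:
  assumes "poisson_counts M X D" "fin_borel_in D B"
  shows "{\<omega> \<in> space M. card (X \<omega> \<inter> B) = 0} \<in> sets M"
    "prob {\<omega> \<in> space M. card (X \<omega> \<inter> B) = 0} = exp (- measure lborel B)"
proof -
  let ?F = "{\<omega> \<in> space M. finite (X \<omega> \<inter> B)}"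
  let ?C = "{\<omega> \<in> space M. finite (X \<omega> \<inter> B) \<and> card (X \<omega> \<inter> B) = 0}"
  have meas: "?C \<in> sets M" and pr: "prob ?C = measure lborel B ^ 0 / fact 0 * exp (- measure lborel B)"
    using assms unfolding poisson_counts_def by blast+
  note F = poisson_finite[OF assms]
  have U: "{\<omega> \<in> space M. card (X \<omega> \<inter> B) = 0} = ?C \<union> (space M - ?F)"
    by (auto dest: card_ge_0_finite)
  show "{\<omega> \<in> space M. card (X \<omega> \<inter> B) = 0} \<in> sets M" unfolding U using meas F(1) by auto
  have "prob (?C \<union> (space M - ?F)) = prob ?C + prob (space M - ?F)"
    using meas F(1) by (intro finite_measure_Union) auto
  also have "prob (space M - ?F) = 0" using prob_compl[OF F(1)] F(2) by simp
  finally show "prob {\<omega> \<in> space M. card (X \<omega> \<inter> B) = 0} = exp (- measure lborel B)"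
    unfolding U pr by simp
qed

text \<open>For mean l the probability is \<open>1 - exp (- l) * (1 + l)\<close>, at most
  \<open>l\<^sup>2\<close> because \<open>exp (- l) \<ge> 1 - l\<close>. The quadratic order makes
  the sum over all strips vanish with the mesh.\<close>

lemma poisson_not_thin:
  assumes "poisson_counts M X D" "fin_borel_in D B"
  shows "{\<omega> \<in> space M. \<not> thin (X \<omega> \<inter> B)} \<in> sets M"
    "prob {\<omega> \<in> space M. \<not> thin (X \<omega> \<inter> B)} \<le> (measure lborel B)\<^sup>2"
proof -
  let ?C = "\<lambda>k. {\<omega> \<in> space M. finite (X \<omega> \<inter> B) \<and> card (X \<omega> \<inter> B) = k}"
  let ?l = "measure lborel B"
  have meas: "?C k \<in> sets M" and pr: "prob (?C k) = ?l ^ k / fact k * exp (- ?l)" for k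
    using assms unfolding poisson_counts_def by blast+
  have U: "{\<omega> \<in> space M. \<not> thin (X \<omega> \<inter> B)} = space M - (?C 0 \<union> ?C 1)"
    by (auto simp: thin_def le_Suc_eq)
  show "{\<omega> \<in> space M. \<not> thin (X \<omega> \<inter> B)} \<in> sets M" unfolding U using meas by auto
  have "prob (space M - (?C 0 \<union> ?C 1)) = 1 - prob (?C 0 \<union> ?C 1)"
    by (rule prob_compl) (use meas in blast)
  also have "prob (?C 0 \<union> ?C 1) = prob (?C 0) + prob (?C 1)"
    by (rule finite_measure_Union) (use meas in auto)
  also have "\<dots> = exp (- ?l) * (1 + ?l)"
    unfolding pr by (simp add: algebra_simps)
  also have "1 - \<dots> \<le> ?l\<^sup>2"
  proof -
    have "(1 - ?l) * (1 + ?l) \<le> exp (- ?l) * (1 + ?l)"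
      using exp_ge_add_one_self[of "- ?l"] by (intro mult_right_mono) auto
    then show ?thesis by (simp add: algebra_simps power2_eq_square)
  qed
  finally show "prob {\<omega> \<in> space M. \<not> thin (X \<omega> \<inter> B)} \<le> (measure lborel B)\<^sup>2" unfolding U .
qed

lemma outer_prob_le:
  assumes "A \<in> sets M" "E \<inter> space M \<subseteq> A"
  shows "outer_prob M E \<le> prob A"
  unfolding outer_prob_def using assms by (intro cINF_lower bdd_belowI[of _ 0]) auto

end

lemma emeasure_lborel_box2:
  fixes a b c d :: real
  assumes "a \<le> b" "c \<le> d"
  shows "emeasure lborel ({a<..b} \<times> {c<..d}) = ennreal ((b - a) * (d - c))"
  using assms
  by (simp add: lborel_prod[symmetric] lborel.emeasure_pair_measure_Times ennreal_mult)

lemma fin_borel_in_box2: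
  fixes a b c d :: real
  assumes "0 \<le> a" "a \<le> b" "0 \<le> c" "c \<le> d"
  shows "fin_borel_in quadrant ({a<..b} \<times> {c<..d})"
    "measure lborel ({a<..b} \<times> {c<..d}) = (b - a) * (d - c)"
proof -
  have "0 \<le> (b - a) * (d - c)" using assms by simp
  then show "measure lborel ({a<..b} \<times> {c<..d}) = (b - a) * (d - c)"
    using emeasure_lborel_box2[OF assms(2,4)] by (simp add: measure_def)
  have "{a<..b} \<times> {c<..d} \<in> sets (borel :: (real \<times> real) measure)"
    by (intro borel_Times) auto
  then show "fin_borel_in quadrant ({a<..b} \<times> {c<..d})"
    using emeasure_lborel_box2[OF assms(2,4)] assms
    by (auto simp: fin_borel_in_def quadrant_def)
qed

lemma fin_borel_in_Ioc:
  fixes a b :: real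
  assumes "0 \<le> a" "a \<le> b"
  shows "fin_borel_in {0<..} {a<..b}" "measure lborel {a<..b} = b - a"
  using assms by (auto simp: fin_borel_in_def)

lemma strip_disjoint: "h > 0 \<Longrightarrow> i \<noteq> j \<Longrightarrow> strip h i \<inter> strip h j = {}"
  by (meson disjoint_iff less_irrefl linorder_neqE_nat strip_less)

lemma prod_list_eq_prod: "prod_list (map w xs) = (\<Prod>i<length xs. w (xs ! i) :: real)"
  by (subst prod.list_conv_set_nth) (simp add: atLeast0LessThan)

definition bern_wt :: "real \<Rightarrow> bool \<Rightarrow> real" where
  "bern_wt p b = (if b then p else 1 - p)"

lemma bits_eq_sum:
  "bits p n f = (\<Sum>xs\<in>lists_of UNIV n. (\<Prod>i<n. bern_wt p (xs ! i)) * f xs)"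
proof -
  have "bits p n f = (\<Sum>xs\<in>lists_of UNIV n. prod_list (map (bern_wt p) xs) * f xs)"
    by (rule iid_eq_sum) (auto simp: bern_def bern_wt_def UNIV_bool)
  then show ?thesis by (auto simp: prod_list_eq_prod intro!: sum.cong)
qed

lemma bitrows_eq_sum:
  "bitrows p n m f =
    (\<Sum>rs\<in>lists_of (lists_of UNIV n) m. (\<Prod>j<m. \<Prod>i<n. bern_wt p (rs ! j ! i)) * f rs)"
proof -
  have "bitrows p n m f = (\<Sum>rs\<in>lists_of (lists_of UNIV n) m.
      prod_list (map (\<lambda>xs. \<Prod>i<n. bern_wt p (xs ! i)) rs) * f rs)"
    by (rule iid_eq_sum) (auto simp: bits_eq_sum finite_lists_length_eq[of UNIV, simplified])
  then show ?thesis by (auto simp: prod_list_eq_prod intro!: sum.cong)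
qed

text \<open>Cells are enumerated by one number, with column \<open>l mod K\<close> and row
  \<open>l div K\<close>, because the independence clause of \<open>hammersley\<close> indexes sets
  by naturals.\<close>

lemma prod_div_mod:
  fixes f :: "nat \<Rightarrow> nat \<Rightarrow> real"
  shows "(\<Prod>l<m * n. f (l div n) (l mod n)) = (\<Prod>j<m. \<Prod>i<n. f j i)"
proof -
  have "(\<Prod>l\<in>{j * n..<j * n + n}. f (l div n) (l mod n)) = (\<Prod>i<n. f j i)" for j
  proof -
    have "(\<Prod>i<n. f j i) = (\<Prod>i\<in>{0..<n}. f ((i + j * n) div n) ((i + j * n) mod n))"
      by (rule prod.cong) auto
    also have "\<dots> = (\<Prod>l\<in>{0 + j * n..<n + j * n}. f (l div n) (l mod n))"
      by (rule prod.shift_bounds_nat_ivl[symmetric])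
    finally show ?thesis by (simp add: add.commute)
  qed
  then show ?thesis by (simp flip: prod.nat_group)
qed

section \<open>Joint law of the occupied cells and source strips\<close>

context
  fixes M :: "'a measure" and P :: "'a \<Rightarrow> (real \<times> real) set" and S :: "'a \<Rightarrow> real set"
    and h :: real and K :: nat
  assumes ham: "hammersley M P S" and h: "h > 0" and K: "K > 0"
begin

interpretation prob_space M using ham by (simp add: hammersley_def)

private lemma poisson_P: "poisson_counts M P quadrant"
  and poisson_S: "poisson_counts M S {0<..}"
  using ham by (simp_all add: hammersley_def)

private lemma fin_cell:
  "fin_borel_in quadrant (strip h i \<times> strip h j)" "measure lborel (strip h i \<times> strip h j) = h\<^sup>2"
proof -
  have "real i * h \<le> real (Suc i) * h" "0 \<le> real i * h" for i :: nat
    using h by (auto simp: algebra_simps)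
  note * = fin_borel_in_box2[OF this(2,1) this(2,1), of i j]
  show "fin_borel_in quadrant (strip h i \<times> strip h j)"
    unfolding strip_def by (rule *)
  show "measure lborel (strip h i \<times> strip h j) = h\<^sup>2"
    unfolding strip_def *(2) by (simp add: algebra_simps power2_eq_square)
qed

private lemma fin_strip: "fin_borel_in {0<..} (strip h i)" "measure lborel (strip h i) = h"
proof -
  have "real i * h \<le> real (Suc i) * h" "0 \<le> real i * h"
    using h by (auto simp: algebra_simps)
  note * = fin_borel_in_Ioc[OF this(2,1)]
  show "fin_borel_in {0<..} (strip h i)" unfolding strip_def by (rule *)
  show "measure lborel (strip h i) = h" unfolding strip_def *(2) by (simp add: algebra_simps)
qed

private lemma indep_cells:
  "indep_vars (\<lambda>_. count_space (UNIV :: nat set))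
     (\<lambda>x \<omega>. case x of Inl l \<Rightarrow> card (P \<omega> \<inter> (strip h (l mod K) \<times> strip h (l div K)))
                | Inr i \<Rightarrow> card (S \<omega> \<inter> strip h i))
     ({..<K * K} <+> {..<K})"
proof -
  have "disjoint_family_on (\<lambda>l. strip h (l mod K) \<times> strip h (l div K)) {..<K * K}"
  proof (unfold disjoint_family_on_def, intro ballI impI)
    fix l l' :: nat assume "l \<noteq> l'"
    then have "l mod K \<noteq> l' mod K \<or> l div K \<noteq> l' div K"
      by (metis div_mult_mod_eq)
    then show "strip h (l mod K) \<times> strip h (l div K) \<inter> strip h (l' mod K) \<times> strip h (l' div K) = {}"
      using strip_disjoint[OF h] by blast
  qed
  moreover have "disjoint_family_on (strip h) {..<K}"
    unfolding disjoint_family_on_def using strip_disjoint[OF h] by auto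
  moreover note ham[unfolded hammersley_def, THEN conjunct2, THEN conjunct2, THEN conjunct2,
      THEN conjunct2, THEN spec[of _ "{..<K * K}"], THEN spec[of _ "{..<K}"],
      THEN spec[of _ "\<lambda>l. strip h (l mod K) \<times> strip h (l div K)"], THEN spec[of _ "strip h"]]
  ultimately show ?thesis
    using fin_cell(1) fin_strip(1) by simp
qed

private abbreviation "p \<equiv> 1 - exp (- h\<^sup>2)"
private abbreviation "\<rho> \<equiv> 1 - exp (- h)"

private lemma cell_prob:
  "{\<omega> \<in> space M. (card (P \<omega> \<inter> (strip h i \<times> strip h j)) \<noteq> 0) = b} \<in> sets M \<and>
    prob {\<omega> \<in> space M. (card (P \<omega> \<inter> (strip h i \<times> strip h j)) \<noteq> 0) = b} = bern_wt p b"
proof -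
  note Z = poisson_card_eq_0[OF poisson_P fin_cell(1)[of i j]]
  have "{\<omega> \<in> space M. card (P \<omega> \<inter> (strip h i \<times> strip h j)) \<noteq> 0}
      = space M - {\<omega> \<in> space M. card (P \<omega> \<inter> (strip h i \<times> strip h j)) = 0}" by auto
  then show ?thesis
    using Z prob_compl[OF Z(1)] sets.compl_sets[OF Z(1)] fin_cell(2)[of i j] by (cases b) (auto simp: bern_wt_def)
qed

private lemma source_prob:
  "{\<omega> \<in> space M. (card (S \<omega> \<inter> strip h i) \<noteq> 0) = b} \<in> sets M \<and>
    prob {\<omega> \<in> space M. (card (S \<omega> \<inter> strip h i) \<noteq> 0) = b} = bern_wt \<rho> b"
proof -
  note Z = poisson_card_eq_0[OF poisson_S fin_strip(1)[of i]]
  have "{\<omega> \<in> space M. card (S \<omega> \<inter> strip h i) \<noteq> 0}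
      = space M - {\<omega> \<in> space M. card (S \<omega> \<inter> strip h i) = 0}" by auto
  then show ?thesis
    using Z prob_compl[OF Z(1)] sets.compl_sets[OF Z(1)] fin_strip(2)[of i] by (cases b) (auto simp: bern_wt_def)
qed

private lemma configuration_prob:
  assumes c: "c \<in> lists_of (lists_of UNIV K) K" and d: "d \<in> lists_of UNIV K"
  defines "E \<equiv> {\<omega> \<in> space M. cell_field h K (P \<omega>) = c \<and> cell_sources h K (S \<omega>) = d}"
  shows "E \<in> sets M"
    "prob E = (\<Prod>j<K. \<Prod>i<K. bern_wt p (c ! j ! i)) * (\<Prod>i<K. bern_wt \<rho> (d ! i))"
proof -
  let ?X = "\<lambda>x \<omega>. case x of Inl l \<Rightarrow> card (P \<omega> \<inter> (strip h (l mod K) \<times> strip h (l div K)))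
                | Inr i \<Rightarrow> card (S \<omega> \<inter> strip h i)"
  let ?I = "{..<K * K} <+> {..<K}"
  let ?A = "\<lambda>x. {n::nat. (n \<noteq> 0) = (case x of Inl l \<Rightarrow> c ! (l div K) ! (l mod K) | Inr i \<Rightarrow> d ! i)}"
  have len: "length c = K" "\<And>j. j < K \<Longrightarrow> length (c ! j) = K" "length d = K"
    using c d by (auto simp: subset_iff)
  have f_eq: "cell_field h K (P \<omega>) = c \<longleftrightarrow>
      (\<forall>j<K. \<forall>i<K. (card (P \<omega> \<inter> (strip h i \<times> strip h j)) \<noteq> 0) = c ! j ! i)" for \<omega>
    using len by (auto simp: cell_field_def list_eq_iff_nth_eq)
  have s_eq: "cell_sources h K (S \<omega>) = d \<longleftrightarrow> (\<forall>i<K. (card (S \<omega> \<inter> strip h i) \<noteq> 0) = d ! i)" for \<omega>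
    using len by (auto simp: cell_sources_def list_eq_iff_nth_eq)
  have ij: "\<exists>l<K * K. l mod K = i \<and> l div K = j" if "i < K" "j < K" for i j
  proof -
    have "j * K + i < j * K + K" using that by simp
    also have "\<dots> = Suc j * K" by simp
    also have "\<dots> \<le> K * K" using that by (intro mult_right_mono) auto
    finally show ?thesis using that by (intro exI[of _ "j * K + i"]) auto
  qed
  have lm: "l mod K < K" "l div K < K" if "l < K * K" for l
    using that K by (auto simp: less_mult_imp_div_less)
  \<comment> \<open>Fixing all bits imposes one condition on each of the independent counts, so the
    probability factorises.\<close>
  have E: "E = (\<Inter>x\<in>?I. ?X x -` ?A x \<inter> space M)" (is "_ = ?R")
  proof (intro set_eqI iffI)
    fix \<omega> assume "\<omega> \<in> E"
    then show "\<omega> \<in> ?R" unfolding E_def f_eq s_eq using lm by (auto split: sum.splits)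
  next
    fix \<omega> assume R: "\<omega> \<in> ?R"
    then have sp: "\<omega> \<in> space M" using K by blast
    have "(card (P \<omega> \<inter> (strip h i \<times> strip h j)) \<noteq> 0) = c ! j ! i" if "i < K" "j < K" for i j
    proof -
      obtain l where l: "l < K * K" "l mod K = i" "l div K = j" using ij \<open>i < K\<close> \<open>j < K\<close> by blast
      then have "\<omega> \<in> ?X (Inl l) -` ?A (Inl l) \<inter> space M" using R by blast
      then show ?thesis using l by simp
    qed
    moreover have "(card (S \<omega> \<inter> strip h i) \<noteq> 0) = d ! i" if "i < K" for i
    proof -
      have "\<omega> \<in> ?X (Inr i) -` ?A (Inr i) \<inter> space M" using R that by blast
      then show ?thesis by simp
    qed
    ultimately show "\<omega> \<in> E" unfolding E_def f_eq s_eq using sp by blast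
  qed
  have single: "?X (Inl l) -` ?A (Inl l) \<inter> space M \<in> sets M"
      "prob (?X (Inl l) -` ?A (Inl l) \<inter> space M) = bern_wt p (c ! (l div K) ! (l mod K))"
      "?X (Inr i) -` ?A (Inr i) \<inter> space M \<in> sets M"
      "prob (?X (Inr i) -` ?A (Inr i) \<inter> space M) = bern_wt \<rho> (d ! i)" for l i
    using cell_prob[of "l mod K" "l div K" "c ! (l div K) ! (l mod K)"] source_prob[of i "d ! i"]
    by (simp_all add: vimage_def Int_def conj_commute)
  show "E \<in> sets M"
    unfolding E using K single(1,3) by (intro sets.finite_INT) auto
  have "prob E = (\<Prod>x\<in>?I. prob (?X x -` ?A x \<inter> space M))"
    unfolding E by (rule indep_varsD_finite[OF indep_cells]) (use K in auto)
  also have "\<dots> = (\<Prod>l<K * K. prob (?X (Inl l) -` ?A (Inl l) \<inter> space M))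
      * (\<Prod>i<K. prob (?X (Inr i) -` ?A (Inr i) \<inter> space M))"
    by (subst prod.Plus) simp_all
  also have "\<dots> = (\<Prod>l<K * K. bern_wt p (c ! (l div K) ! (l mod K))) * (\<Prod>i<K. bern_wt \<rho> (d ! i))"
    unfolding single(2,4) ..
  finally show "prob E = (\<Prod>j<K. \<Prod>i<K. bern_wt p (c ! j ! i)) * (\<Prod>i<K. bern_wt \<rho> (d ! i))"
    by (simp add: prod_div_mod[where f = "\<lambda>j i. bern_wt p (c ! j ! i)"])
qed

text \<open>An event depending only on the bits is a finite disjoint union of configurations. This
  transfers the finite expectations to the given probability space and supplies
  measurability.\<close>

lemma configuration_law:
  fixes Q :: "bool list list \<Rightarrow> bool list \<Rightarrow> bool"
  defines "E \<equiv> {\<omega> \<in> space M. Q (cell_field h K (P \<omega>)) (cell_sources h K (S \<omega>))}"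
  shows "E \<in> sets M"
    "prob E = bitrows p K K (\<lambda>rs. bits \<rho> K (\<lambda>ws. of_bool (Q rs ws)))"
proof -
  let ?C = "lists_of (lists_of UNIV K) K :: bool list list set" and ?D = "lists_of UNIV K :: bool list set"
  let ?E = "\<lambda>z. {\<omega> \<in> space M. cell_field h K (P \<omega>) = fst z \<and> cell_sources h K (S \<omega>) = snd z}"
  let ?Z = "{z \<in> ?C \<times> ?D. Q (fst z) (snd z)}"
  have finD: "finite ?D" using finite_lists_length_eq[of "UNIV :: bool set" K] by simp
  have finC: "finite ?C" by (rule finite_lists_length_eq[OF finD])
  have E: "E = (\<Union>z\<in>?Z. ?E z)"
    unfolding E_def using cell_field_lists_of[of h K] by (fastforce simp: cell_sources_def)
  have Zs: "?E z \<in> sets M" if "z \<in> ?C \<times> ?D" for z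
    using configuration_prob(1)[of "fst z" "snd z"] that by (auto simp: mem_Times_iff)
  have finZ: "finite ?Z" using finC finD by auto
  show "E \<in> sets M" unfolding E using finZ Zs by (intro sets.finite_UN) auto
  have "prob E = (\<Sum>z\<in>?Z. prob (?E z))"
    unfolding E using finZ Zs by (intro finite_measure_finite_Union) (auto simp: disjoint_family_on_def)
  also have "\<dots> = (\<Sum>z\<in>?C \<times> ?D. of_bool (Q (fst z) (snd z)) * prob (?E z))"
    using finC finD by (intro sum.mono_neutral_cong_left) auto
  also have "\<dots> = (\<Sum>z\<in>?C \<times> ?D. of_bool (Q (fst z) (snd z)) *
      ((\<Prod>j<K. \<Prod>i<K. bern_wt p (fst z ! j ! i)) * (\<Prod>i<K. bern_wt \<rho> (snd z ! i))))"
    using configuration_prob(2) by (intro sum.cong) (auto simp: mem_Times_iff)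
  also have "\<dots> = bitrows p K K (\<lambda>rs. bits \<rho> K (\<lambda>ws. of_bool (Q rs ws)))"
    by (subst bitrows_eq_sum, subst bits_eq_sum,
        subst sum_distrib_left, subst sum.cartesian_product)
      (intro sum.cong, auto simp: mult_ac)
  finally show "prob E = bitrows p K K (\<lambda>rs. bits \<rho> K (\<lambda>ws. of_bool (Q rs ws)))" .
qed

end

section \<open>Passage to the limit\<close>

text \<open>The supremum event lies in the measurable union of a cell event and the event that some
  strip is not thin, which suffices for the outer probability.\<close>

lemma outer_prob_cell_bound:
  fixes P :: "'a \<Rightarrow> (real \<times> real) set" and S :: "'a \<Rightarrow> real set" and t Z m :: real and K :: nat
  assumes ham: "hammersley M P S" and t: "t > 0" and K: "K > 0" and Z: "0 \<le> Z" "Z < t"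
  defines "h \<equiv> t / real K"
  shows "outer_prob M {\<omega> \<in> space M.
       (SUP z\<in>{0..Z}. real (Nsrc (S \<omega>) z + Alen (P \<omega>) t z)) - real (Alen (P \<omega>) t 0) \<ge> m}
    \<le> bitrows (1 - exp (- h\<^sup>2)) K K (\<lambda>rs. bits (1 - exp (- h)) K (\<lambda>ws.
         of_bool (\<exists>k\<le>nat \<lfloor>Z / h\<rfloor>. m - 1 \<le> real (ones (take k ws))
            - real (ones (take k (top_row (zeros K) (zeros K) rs))))))
      + (2 * t ^ 4 + t\<^sup>2) / real K"
proof -
  interpret prob_space M using ham by (simp add: hammersley_def)
  have h: "h > 0" using t K by (simp add: h_def)
  have pP: "poisson_counts M P quadrant" and pS: "poisson_counts M S {0<..}"
    using ham by (simp_all add: hammersley_def)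
  have ih: "0 \<le> real i * h" "real i * h \<le> real (Suc i) * h" for i :: nat
    using h by (auto simp: algebra_simps)
  define X where "X i = {\<omega> \<in> space M. \<not> thin (P \<omega> \<inter> (strip h i \<times> {0<..t}))}" for i
  define Y where "Y j = {\<omega> \<in> space M. \<not> thin (P \<omega> \<inter> ({0<..t} \<times> strip h j))}" for j
  define W where "W i = {\<omega> \<in> space M. \<not> thin (S \<omega> \<inter> strip h i)}" for i
  have t0: "0 \<le> t" using t by simp
  have X: "X i \<in> sets M" "prob (X i) \<le> (h * t)\<^sup>2" for i
    using poisson_not_thin[OF pP fin_borel_in_box2(1)[OF ih order.refl t0, of i]]
      fin_borel_in_box2(2)[OF ih order.refl t0, of i]
    by (auto simp: X_def strip_def algebra_simps)
  have Y: "Y i \<in> sets M" "prob (Y i) \<le> (h * t)\<^sup>2" for i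
    using poisson_not_thin[OF pP fin_borel_in_box2(1)[OF order.refl t0 ih, of i]]
      fin_borel_in_box2(2)[OF order.refl t0 ih, of i]
    by (auto simp: Y_def strip_def algebra_simps)
  have W: "W i \<in> sets M" "prob (W i) \<le> h\<^sup>2" for i
    using poisson_not_thin[OF pS fin_borel_in_Ioc(1)[OF ih, of i]] fin_borel_in_Ioc(2)[OF ih, of i]
    by (auto simp: W_def strip_def algebra_simps)
  define bad where "bad = (\<Union>i<K. X i) \<union> (\<Union>i<K. Y i) \<union> (\<Union>i<K. W i)"
  define Q where "Q rs ws \<longleftrightarrow> (\<exists>k\<le>nat \<lfloor>Z / h\<rfloor>. m - 1 \<le> real (ones (take k ws))
            - real (ones (take k (top_row (zeros K) (zeros K) rs))))" for rs ws
  define E where "E = {\<omega> \<in> space M. Q (cell_field h K (P \<omega>)) (cell_sources h K (S \<omega>))}"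
  have bad: "bad \<in> sets M" unfolding bad_def using X(1) Y(1) W(1) by auto
  note law = configuration_law[OF ham h K, of Q, folded E_def]
  have "prob bad \<le> (prob (\<Union>i<K. X i) + prob (\<Union>i<K. Y i)) + prob (\<Union>i<K. W i)"
    unfolding bad_def using X(1) Y(1) W(1)
    by (intro order.trans[OF measure_Un_le] add_mono order.refl sets.Un sets.finite_UN) auto
  also have "\<dots> \<le> ((\<Sum>i<K. prob (X i)) + (\<Sum>i<K. prob (Y i))) + (\<Sum>i<K. prob (W i))"
    using X(1) Y(1) W(1) by (intro add_mono finite_measure_subadditive_finite) auto
  \<comment> \<open>There are \<open>2 * K\<close> boxes of area \<open>h * t\<close> and
    \<open>K\<close> intervals of length \<open>h = t / K\<close>, each entering squared.\<close>
  also have "\<dots> \<le> ((\<Sum>i<K. (h * t)\<^sup>2) + (\<Sum>i<K. (h * t)\<^sup>2)) + (\<Sum>i<K. h\<^sup>2)"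
    using X(2) Y(2) W(2) by (intro add_mono sum_mono)
  also have "\<dots> = (2 * t ^ 4 + t\<^sup>2) / real K"
    using K by (simp add: h_def field_simps power2_eq_square power4_eq_xxxx)
  finally have prob_bad: "prob bad \<le> (2 * t ^ 4 + t\<^sup>2) / real K" .
  have "outer_prob M {\<omega> \<in> space M.
       (SUP z\<in>{0..Z}. real (Nsrc (S \<omega>) z + Alen (P \<omega>) t z)) - real (Alen (P \<omega>) t 0) \<ge> m} \<le> prob (E \<union> bad)"
  proof (rule outer_prob_le)
    show "E \<union> bad \<in> sets M" using law(1) bad by auto
    show "{\<omega> \<in> space M. (SUP z\<in>{0..Z}. real (Nsrc (S \<omega>) z + Alen (P \<omega>) t z))
        - real (Alen (P \<omega>) t 0) \<ge> m} \<inter> space M \<subseteq> E \<union> bad"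
    proof
      fix \<omega> assume \<omega>: "\<omega> \<in> {\<omega> \<in> space M. (SUP z\<in>{0..Z}. real (Nsrc (S \<omega>) z + Alen (P \<omega>) t z))
        - real (Alen (P \<omega>) t 0) \<ge> m} \<inter> space M"
      show "\<omega> \<in> E \<union> bad"
      proof (cases "\<omega> \<in> bad")
        case False
        have "\<exists>k\<le>nat \<lfloor>Z / h\<rfloor>. m - 1 \<le> real (ones (take k (cell_sources h K (S \<omega>))))
            - real (ones (take k (top_row (zeros K) (zeros K) (cell_field h K (P \<omega>)))))"
          by (rule cell_event[OF K t _ _ _ _ Z])
            (use False \<omega> in \<open>auto simp: bad_def X_def Y_def W_def h_def\<close>)
        then show ?thesis using \<omega> by (auto simp: E_def Q_def)
      qed simp
    qed
  qed
  also have "\<dots> \<le> prob E + prob bad"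
    using law(1) bad by (rule measure_Un_le)
  finally show ?thesis
    using prob_bad law(2) unfolding Q_def by simp
qed

text \<open>The square root of the occupation probability of a cell, so that odds
  \<open>q * exp (- s)\<close> and \<open>q * exp s\<close> satisfy Burke's condition.\<close>

definition mesh_q :: "real \<Rightarrow> nat \<Rightarrow> real" where
  "mesh_q t K = sqrt (1 - exp (- (t / real K)\<^sup>2))"

lemma mesh_q_bounds:
  assumes "t > 0" "K > 0"
  shows "0 < mesh_q t K" "mesh_q t K \<le> 1" "(mesh_q t K)\<^sup>2 = 1 - exp (- (t / real K)\<^sup>2)"
    "mesh_q t K \<le> t / real K"
proof -
  have "0 < (t / real K)\<^sup>2" using assms by simp
  then have "exp (- (t / real K)\<^sup>2) < 1" by simp
  then show "0 < mesh_q t K" "mesh_q t K \<le> 1" "(mesh_q t K)\<^sup>2 = 1 - exp (- (t / real K)\<^sup>2)"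
    by (simp_all add: mesh_q_def)
  have "1 - exp (- (t / real K)\<^sup>2) \<le> (t / real K)\<^sup>2"
    using exp_ge_add_one_self[of "- (t / real K)\<^sup>2"] by linarith
  then show "mesh_q t K \<le> t / real K"
    unfolding mesh_q_def using assms by (intro real_le_lsqrt) auto
qed

text \<open>The drift of the walk is nonnegative, so its exponential is a submartingale.\<close>

lemma walk_factor_ge_1:
  fixes a \<rho> x :: real
  assumes "0 \<le> a" "a \<le> \<rho>" "\<rho> \<le> 1" "1 \<le> x"
  shows "1 \<le> (1 - \<rho> + \<rho> * x) * (1 - a + a / x)"
proof -
  have "a * (1 - \<rho>) \<le> \<rho> * (1 - a)" using assms by (simp add: algebra_simps)
  moreover have "a * (1 - \<rho>) / x \<le> a * (1 - \<rho>) / 1"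
    using assms by (intro divide_left_mono) auto
  ultimately have "0 \<le> (x - 1) * (\<rho> * (1 - a) - a * (1 - \<rho>) / x)"
    using assms by (intro mult_nonneg_nonneg) auto
  also have "\<dots> = (1 - \<rho> + \<rho> * x) * (1 - a + a / x) - 1"
    using assms by (simp add: field_simps)
  finally show ?thesis by simp
qed

lemma mesh_bound:
  fixes P :: "'a \<Rightarrow> (real \<times> real) set" and S :: "'a \<Rightarrow> real set" and t Z m :: real and K :: nat
  assumes ham: "hammersley M P S" and t: "t > 0" and K: "K > 0" and Z: "0 \<le> Z" "Z < t"
    and s: "0 \<le> s" and \<eta>: "0 \<le> \<eta>"
  shows "outer_prob M {\<omega> \<in> space M.
       (SUP z\<in>{0..Z}. real (Nsrc (S \<omega>) z + Alen (P \<omega>) t z)) - real (Alen (P \<omega>) t 0) \<ge> m}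
    \<le> exit_bound (mesh_q t K) K s l
      + exp (- \<eta> * (m - 1)) * exp (Z / (t / real K) * ((1 - exp (- (t / real K))) * (exp \<eta> - 1)
          + of_odds (mesh_q t K * exp (- s)) * (exp (- \<eta>) - 1)))
      + (2 * t ^ 4 + t\<^sup>2) / real K"
proof -
  define h q a \<rho> where "h = t / real K" and "q = mesh_q t K"
    and "a = of_odds (q * exp (- s))" and "\<rho> = 1 - exp (- h)"
  define \<phi> where "\<phi> = (1 - \<rho> + \<rho> * exp \<eta>) * (1 - a + a * exp (- \<eta>))"
  define g where "g = \<rho> * (exp \<eta> - 1) + a * (exp (- \<eta>) - 1)"
  note q = mesh_q_bounds[OF t K, folded q_def h_def]
  have h: "h > 0" using t K by (simp add: h_def)
  have \<rho>: "0 \<le> \<rho>" "\<rho> \<le> 1" using h by (auto simp: \<rho>_def)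
  have a0: "0 \<le> a" unfolding a_def using q by (intro of_odds_bounds) auto
  \<comment> \<open>The stationary row is sparser than the sources: its odds are at most
    \<open>h\<close>, and \<open>1 - 1 / (1 + h) \<le> 1 - exp (- h)\<close>.\<close>
  have "a \<le> \<rho>"
  proof -
    have "q * exp (- s) \<le> h * 1" using q s h by (intro mult_mono) auto
    then have "1 / (1 + h) \<le> 1 / (1 + q * exp (- s))"
      using q(1) h by (intro divide_left_mono mult_pos_pos add_pos_pos) auto
    also have "\<dots> = 1 - a" unfolding a_def using q by (simp add: one_minus_of_odds)
    finally have "a \<le> 1 - 1 / (1 + h)" by simp
    also have "exp (- h) \<le> 1 / (1 + h)"
      unfolding exp_minus inverse_eq_divide using h exp_ge_add_one_self[of h]
      by (intro divide_left_mono mult_pos_pos) auto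
    then have "1 - 1 / (1 + h) \<le> \<rho>" by (simp add: \<rho>_def)
    finally show ?thesis .
  qed
  then have \<phi>1: "1 \<le> \<phi>"
    unfolding \<phi>_def using walk_factor_ge_1[of a \<rho> "exp \<eta>"] a0 \<rho> \<eta> by (simp add: exp_minus field_simps)
  have a1: "a \<le> 1" using \<open>a \<le> \<rho>\<close> \<rho> by simp
  have "\<phi> = (1 + \<rho> * (exp \<eta> - 1)) * (1 + a * (exp (- \<eta>) - 1))"
    by (simp add: \<phi>_def algebra_simps)
  also have "\<dots> \<le> exp (\<rho> * (exp \<eta> - 1)) * exp (a * (exp (- \<eta>) - 1))"
  proof (intro mult_mono exp_ge_add_one_self)
    have "0 \<le> (1 - a) + a * exp (- \<eta>)" using a0 a1 by simp
    then show "0 \<le> 1 + a * (exp (- \<eta>) - 1)" by (simp add: algebra_simps)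
  qed simp
  also have "\<dots> = exp g" by (simp add: g_def exp_add)
  finally have \<phi>g: "\<phi> \<le> exp g" .
  \<comment> \<open>The sign allows the number of steps to be rounded up from the floor to
    \<open>Z / h\<close>.\<close>
  have g0: "0 \<le> g"
  proof -
    have "1 \<le> exp g" using \<phi>1 \<phi>g by linarith
    then show ?thesis by simp
  qed
  have "\<phi> ^ nat \<lfloor>Z / h\<rfloor> \<le> exp g ^ nat \<lfloor>Z / h\<rfloor>"
    using \<phi>1 \<phi>g by (intro power_mono) auto
  also have "\<dots> = exp (real (nat \<lfloor>Z / h\<rfloor>) * g)" by (simp add: exp_of_nat_mult)
  also have "\<dots> \<le> exp (Z / h * g)"
  proof -
    have "0 \<le> Z / h" using Z h by simp
    then have "real (nat \<lfloor>Z / h\<rfloor>) \<le> Z / h" by linarith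
    then have "real (nat \<lfloor>Z / h\<rfloor>) * g \<le> Z / h * g" using g0 by (rule mult_right_mono)
    then show ?thesis by simp
  qed
  finally have pow: "\<phi> ^ nat \<lfloor>Z / h\<rfloor> \<le> exp (Z / h * g)" .
  have "bitrows (q\<^sup>2) K K (\<lambda>rs. bits \<rho> K (\<lambda>ws.
         of_bool (\<exists>k\<le>nat \<lfloor>Z / h\<rfloor>. m - 1 \<le> real (ones (take k ws))
            - real (ones (take k (top_row (zeros K) (zeros K) rs))))))
      \<le> exit_bound q K s l + exp (- \<eta> * (m - 1)) * \<phi> ^ nat \<lfloor>Z / h\<rfloor>"
    unfolding \<phi>_def a_def
    by (rule discrete_bound[OF q(1,2) s \<rho> \<phi>1[unfolded \<phi>_def a_def] \<eta>])
  also have "\<dots> \<le> exit_bound q K s l + exp (- \<eta> * (m - 1)) * exp (Z / h * g)"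
    using pow by (intro add_left_mono mult_left_mono) auto
  finally show ?thesis
    using outer_prob_cell_bound[OF ham t K Z, of m, folded h_def, folded q(3)]
    unfolding g_def \<rho>_def a_def q_def h_def by linarith
qed

section \<open>Vanishing mesh, then large t\<close>

lemma tilt_limit:
  assumes "t > 0"
  shows "(\<lambda>K. tilt (mesh_q t K) K a) \<longlonglongrightarrow> exp (t * (exp a - exp (- a)))"
proof -
  \<comment> \<open>A positive variable \<open>A\<close> stands for \<open>exp a\<close>. As
    \<open>mesh_q t K\<close> is asymptotic to \<open>t / real K\<close>, the base is
    \<open>1 + (t / K) * (A - 1 / A)\<close> to first order.\<close>
  have "(\<lambda>K::nat. ((1 + sqrt (1 - exp (- (t / real K)\<^sup>2)) * A)
      / (1 + sqrt (1 - exp (- (t / real K)\<^sup>2)) * (1 / A))) ^ K) \<longlonglongrightarrow> exp (t * (A - 1 / A))"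
    if "A > 0" for A :: real
    using assms that by (real_asymp, simp add: field_simps)
  from this[of "exp a"] show ?thesis
    by (simp add: tilt_def mesh_q_def exp_minus inverse_eq_divide)
qed

definition exit_limit :: "real \<Rightarrow> real \<Rightarrow> real \<Rightarrow> real" where
  "exit_limit t s l =
     exp (- (s + s / 2) * l + t * (exp s - exp (- s)) + t * (exp (s / 2) - exp (- (s / 2))))
   + (exp (- (s / 2 + - s) * l + t * (exp (s / 2) - exp (- (s / 2))) + t * (exp (- s) - exp s))
   + exp (- (s / 2 + s / 2) * l + t * (exp (s / 2) - exp (- (s / 2))) + t * (exp (s / 2) - exp (- (s / 2)))))"

lemma exit_bound_limit:
  assumes "t > 0"
  shows "(\<lambda>K. exit_bound (mesh_q t K) K s l) \<longlonglongrightarrow> exit_limit t s l"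
proof -
  have "(\<lambda>K. tilt (mesh_q t K) K (- s)) \<longlonglongrightarrow> exp (t * (exp (- s) - exp s))"
    using tilt_limit[OF assms, of "- s"] by simp
  with tilt_limit[OF assms] show ?thesis
    unfolding exit_bound_def exit_limit_def exp_add mult.assoc by (intro tendsto_intros)
qed

text \<open>The left side does not involve the mesh, so \<open>K\<close> may tend to infinity in
  \<open>mesh_bound\<close>, and the discretisation error disappears.\<close>

lemma continuum_bound:
  fixes P :: "'a \<Rightarrow> (real \<times> real) set" and S :: "'a \<Rightarrow> real set" and t Z m :: real
  assumes ham: "hammersley M P S" and t: "t > 0" and Z: "0 < Z" "Z < t"
    and s: "0 < s" and \<eta>: "0 < \<eta>"
  shows "outer_prob M {\<omega> \<in> space M.
       (SUP z\<in>{0..Z}. real (Nsrc (S \<omega>) z + Alen (P \<omega>) t z)) - real (Alen (P \<omega>) t 0) \<ge> m}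
    \<le> exit_limit t s l + exp (- \<eta> * (m - 1)) * exp (Z * ((exp \<eta> - 1) + exp (- s) * (exp (- \<eta>) - 1)))"
proof (rule tendsto_lowerbound[OF _ _ sequentially_bot])
  have "(\<lambda>K::nat. Z / (t / real K) * ((1 - exp (- (t / real K))) * (A - 1)
      + sqrt (1 - exp (- (t / real K)\<^sup>2)) * B / (1 + sqrt (1 - exp (- (t / real K)\<^sup>2)) * B) * (1 / A - 1)))
      \<longlonglongrightarrow> Z * ((A - 1) + B * (1 / A - 1))" if "A > 1" "B < 1" "B > 0" for A B :: real
    using t Z that by (real_asymp, simp add: field_simps)
  from this[of "exp \<eta>" "exp (- s)"]
  have lim: "(\<lambda>K. Z / (t / real K) * ((1 - exp (- (t / real K))) * (exp \<eta> - 1)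
          + of_odds (mesh_q t K * exp (- s)) * (exp (- \<eta>) - 1)))
      \<longlonglongrightarrow> Z * ((exp \<eta> - 1) + exp (- s) * (exp (- \<eta>) - 1))"
    using s \<eta> by (simp add: of_odds_def mesh_q_def exp_minus inverse_eq_divide)
  have "(\<lambda>K. (2 * t ^ 4 + t\<^sup>2) / real K) \<longlonglongrightarrow> 0"
    by (rule lim_const_over_n)
  from tendsto_add[OF tendsto_add[OF exit_bound_limit[OF t, of s l]
        tendsto_mult_left[OF tendsto_exp[OF lim], of "exp (- \<eta> * (m - 1))"]] this]
  show "(\<lambda>K. exit_bound (mesh_q t K) K s l
      + exp (- \<eta> * (m - 1)) * exp (Z / (t / real K) * ((1 - exp (- (t / real K))) * (exp \<eta> - 1)
          + of_odds (mesh_q t K * exp (- s)) * (exp (- \<eta>) - 1)))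
      + (2 * t ^ 4 + t\<^sup>2) / real K)
    \<longlonglongrightarrow> exit_limit t s l + exp (- \<eta> * (m - 1)) * exp (Z * ((exp \<eta> - 1) + exp (- s) * (exp (- \<eta>) - 1)))"
    by simp
  show "\<forall>\<^sub>F K in sequentially. outer_prob M {\<omega> \<in> space M.
       (SUP z\<in>{0..Z}. real (Nsrc (S \<omega>) z + Alen (P \<omega>) t z)) - real (Alen (P \<omega>) t 0) \<ge> m}
      \<le> exit_bound (mesh_q t K) K s l
      + exp (- \<eta> * (m - 1)) * exp (Z / (t / real K) * ((1 - exp (- (t / real K))) * (exp \<eta> - 1)
          + of_odds (mesh_q t K * exp (- s)) * (exp (- \<eta>) - 1)))
      + (2 * t ^ 4 + t\<^sup>2) / real K"
    using eventually_gt_at_top[of 0]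
    by eventually_elim (use assms in \<open>intro mesh_bound, auto\<close>)
qed

text \<open>With \<open>s ^ 3 * t = r ^ 3\<close> fixed, the linear terms cancel against
  \<open>2 * t\<close> and the cubic ones remain. The coefficient 1/3 in the level makes the first
  two exponents equal.\<close>

lemma exit_limit_scaling:
  fixes r :: real
  assumes "r > 0"
  defines "s \<equiv> \<lambda>t. r * t powr (- 1 / 3)"
  shows "((\<lambda>t. exit_limit t (s t) (2 * t + (s t)\<^sup>2 * t / 3))
    \<longlongrightarrow> exp (- (r ^ 3) / 8) + (exp (- (r ^ 3) / 8) + exp (- (r ^ 3) / 4))) at_top"
  unfolding exit_limit_def s_def using assms(1)
  by (intro tendsto_add tendsto_exp;
      real_asymp, simp add: field_simps power2_eq_square power3_eq_cube)

text \<open>The first-order terms of the two exponentials cancel. At second order the drift leaves x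
  * r and the variance x ^ 2, both multiplied by \<epsilon>.\<close>

lemma walk_limit_scaling:
  fixes r x \<epsilon> L :: real
  assumes "r > 0" "x > 0" "\<epsilon> > 0" "L > 0"
  shows "((\<lambda>t. - (x * t powr (- 1 / 3)) * (L * t powr (1 / 3) - 1)
      + \<epsilon> * t powr (2 / 3) * ((exp (x * t powr (- 1 / 3)) - 1)
         + exp (- (r * t powr (- 1 / 3))) * (exp (- (x * t powr (- 1 / 3))) - 1)))
    \<longlongrightarrow> - x * L + \<epsilon> * x * (x + r)) at_top"
  using assms by (real_asymp, simp add: algebra_simps)

theorem theorem5p1:
  fixes L :: real
  assumes "L > 0"
  shows "\<exists>C::real. \<exists>\<epsilon>0::real. \<epsilon>0 > 0 \<and>
    (\<forall>(M::'a measure) P S. hammersley M P S \<longrightarrow>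
      (\<forall>\<epsilon>::real. 0 < \<epsilon> \<and> \<epsilon> < \<epsilon>0 \<longrightarrow>
         Limsup at_top (\<lambda>t::real. ereal (outer_prob M
           {\<omega> \<in> space M.
              (SUP z \<in> {0..\<epsilon> * t powr (2/3)}. real (Nsrc (S \<omega>) z + Alen (P \<omega>) t z))
                - real (Alen (P \<omega>) t 0) \<ge> L * t powr (1/3)}))
         \<le> ereal (C * \<epsilon> ^ 3)))"
\<comment> \<open>The first summand covers the exit terms,
  \<open>20 / r ^ 3 = 160 * \<epsilon> ^ 3 / L ^ 3\<close>; the second comes from the walk, with
  \<open>110592 = 27 * 16 ^ 3\<close>.\<close>
proof (rule exI[of _ "192 / L ^ 3 + 110592 / L ^ 6"], rule exI[of _ 1], intro conjI allI impI)
  fix M :: "'a measure" and P S and \<epsilon> :: real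
  assume ham: "hammersley M P S" and \<epsilon>: "0 < \<epsilon> \<and> \<epsilon> < 1"
  \<comment> \<open>This r lets the drift consume half of L. The value of x then minimises
    \<open>- x * L + \<epsilon> * x * (x + r)\<close>, with minimum
    \<open>- (L\<^sup>2) / (16 * \<epsilon>)\<close>.\<close>
  define r x where "r = L / (2 * \<epsilon>)" and "x = L / (4 * \<epsilon>)"
  have pos: "r > 0" "x > 0" "\<epsilon> > 0" using assms \<epsilon> by (auto simp: r_def x_def)
  let ?p = "\<lambda>t. outer_prob M {\<omega> \<in> space M.
     (SUP z \<in> {0..\<epsilon> * t powr (2/3)}. real (Nsrc (S \<omega>) z + Alen (P \<omega>) t z))
       - real (Alen (P \<omega>) t 0) \<ge> L * t powr (1/3)}"
  let ?s = "\<lambda>t. r * t powr (- 1 / 3)" and ?\<eta> = "\<lambda>t. x * t powr (- 1 / 3)"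
  let ?w = "\<lambda>t. - ?\<eta> t * (L * t powr (1 / 3) - 1)
      + \<epsilon> * t powr (2 / 3) * ((exp (?\<eta> t) - 1) + exp (- ?s t) * (exp (- ?\<eta> t) - 1))"
  let ?b = "\<lambda>t. exit_limit t (?s t) (2 * t + (?s t)\<^sup>2 * t / 3) + exp (?w t)"
  define c where "c = exp (- (r ^ 3) / 8) + (exp (- (r ^ 3) / 8) + exp (- (r ^ 3) / 4))
    + exp (- x * L + \<epsilon> * x * (x + r))"
  have lim: "(?b \<longlongrightarrow> c) at_top"
    unfolding c_def
    by (intro tendsto_add tendsto_exp exit_limit_scaling walk_limit_scaling pos assms)
  have "\<forall>\<^sub>F t in at_top. ?p t \<le> ?b t"
  proof -
    have "\<forall>\<^sub>F t in at_top. \<epsilon> * t powr (2 / 3) < t"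
      using pos by real_asymp
    then show ?thesis
      using eventually_gt_at_top[of 0]
    proof eventually_elim
      case (elim t)
      then show ?case
        unfolding exp_add using pos by (intro continuum_bound[OF ham]) auto
    qed
  qed
  then have "Limsup at_top (\<lambda>t. ereal (?p t)) \<le> Limsup at_top (\<lambda>t. ereal (?b t))"
    by (intro Limsup_mono) (auto elim: eventually_mono)
  also have "\<dots> = ereal c"
    using lim by (intro lim_imp_Limsup) (auto simp: trivial_limit_at_top_linorder)
  also have "ereal c \<le> ereal ((192 / L ^ 3 + 110592 / L ^ 6) * \<epsilon> ^ 3)"
  proof -
    \<comment> \<open>The exit exponents are already of order \<epsilon> to the power -3, so this
      crude bound gives the required cube.\<close>
    have inv: "exp (- y) \<le> 1 / y" if "y > 0" for y :: real
    proof -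
      have "y \<le> exp y" using exp_ge_add_one_self[of y] by linarith
      then show ?thesis using that by (simp add: exp_minus inverse_eq_divide field_simps)
    qed
    have r3: "r ^ 3 > 0" using pos by simp
    have "exp (- (r ^ 3) / 8) \<le> 8 / r ^ 3" using inv[of "r ^ 3 / 8"] r3 by simp
    moreover have "exp (- (r ^ 3) / 4) \<le> 4 / r ^ 3" using inv[of "r ^ 3 / 4"] r3 by simp
    moreover have "8 / r ^ 3 + (8 / r ^ 3 + 4 / r ^ 3) \<le> 192 / L ^ 3 * \<epsilon> ^ 3"
      using assms \<epsilon> by (simp add: r_def power_divide power_mult_distrib field_simps)
    moreover have "exp (- x * L + \<epsilon> * x * (x + r)) \<le> 110592 / L ^ 6 * \<epsilon> ^ 3"
    proof -
      define y where "y = L\<^sup>2 / (16 * \<epsilon>)"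
      have y: "y > 0" using assms \<epsilon> by (simp add: y_def)
      have "- x * L + \<epsilon> * x * (x + r) = - y"
        using assms \<epsilon> by (simp add: x_def r_def y_def field_simps power2_eq_square)
      \<comment> \<open>Here y is only of order 1 / \<epsilon>, so three powers of it are extracted
        from the exponential.\<close>
      moreover have "(y / 3) ^ 3 \<le> exp y"
      proof -
        have "(y / 3) ^ 3 \<le> exp (y / 3) ^ 3"
          using y exp_ge_add_one_self[of "y / 3"] by (intro power_mono) linarith+
        also have "\<dots> = exp y" using exp_of_nat_mult[of 3 "y / 3"] by simp
        finally show ?thesis .
      qed
      then have "exp (- y) \<le> 27 / y ^ 3"
        using y by (simp add: exp_minus inverse_eq_divide field_simps)
      moreover have "27 / y ^ 3 = 110592 / L ^ 6 * \<epsilon> ^ 3"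
        using assms \<epsilon> by (simp add: y_def power_divide power_mult_distrib flip: power_mult)
      ultimately show ?thesis by simp
    qed
    ultimately show ?thesis
      unfolding c_def distrib_right ereal_less_eq by linarith
  qed
  finally show "Limsup at_top (\<lambda>t. ereal (?p t)) \<le> ereal ((192 / L ^ 3 + 110592 / L ^ 6) * \<epsilon> ^ 3)" .
qed simp

end
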